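(* Let $\mathbb{A}$, $\mathbb{B}$ be finite relational structures and let $\mathscr{A}$, $\mathscr{B}$ be their polymorphism clones. Then the following are equivalent. \begin{itemize} \item[(i)] $\mathbb{B}$ is homomorphically equivalent to a pp-power of $\mathbb{A}$. \item[(i')] $\mathbb{B}$ can be pp-constructed from $\mathbb{A}$, i.e. obtained from $\mathbb{A}$ by a finite number of the constructions (a), (b), (c) described in the context. \item[(ii)] $\mathscr{B}\in \mathsf{E}\mathsf{R}\mathsf{P}_{\mathrm{fin}}\,\mathscr{A}$. \item[(ii')] $\mathscr{B}\in \mathsf{E}\mathsf{R}\mathsf{P}\,\mathscr{A}$. \item[(iii)] There exists an h1 clone homomorphism from $\mathscr{A}$ into $\mathscr{B}$. \end{itemize}
   Context: Relational structures have nonempty domains; $A$ denotes the domain of $\mathbb{A}$. The polymorphism clone of $\mathbb{A}$ is the set of all finitary operations (of arity $\ge 1$) on $A$ preserving all relations of $\mathbb{A}$. A function clone is a set of finitary operations (arity $\ge 1$) on a nonempty set containing all projections and closed under composition; $\pi^m_i$ denotes the $m$-ary projection onto the $i$-th coordinate. pp-formulas: first-order formulas built from the relation symbols, equality, conjunction and existential quantification; a relation is pp-definable in $\mathbb{A}$ if it is defined by a pp-formula over $\mathbb{A}$ without parameters (the empty relation is counted as pp-definable). pp-power: $\mathbb{C}$ is a pp-power of $\mathbb{A}$ if it is isomorphic to a structure with domain $A^n$, $n\ge 1$, all of whose relations are pp-definable from $\mathbb{A}$, where a $k$-ary relation on $A^n$ is regarded as a $kn$-ary relation on $A$. pp-interpretation: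 $\mathbb{A}$ pp-interprets $\mathbb{C}$ if there are $n\ge 1$ and a map $f$ from a subset of $A^n$ onto $C$ such that the domain of $f$, the $f$-preimage of equality on $C$ (a $2n$-ary relation on $A$), and the $f$-preimage of every relation of $\mathbb{C}$ are pp-definable in $\mathbb{A}$. Homomorphic equivalence: two structures of the same signature are homomorphically equivalent if there are homomorphisms between them in both directions. Constructions: (a) passing from $\mathbb{C}$ to a structure pp-interpretable in $\mathbb{C}$; (b) passing from $\mathbb{C}$ to a structure homomorphically equivalent to $\mathbb{C}$; (c) if $\mathbb{C}$ is an at most countable $\omega$-categorical model-complete core, passing to an expansion of $\mathbb{C}$ by a singleton unary relation. (A model-complete core is a structure whose automorphisms are dense in its endomorphisms: every endomorphism agrees on every finite set with some automorphism. For finite structures this means every endomorphism is an automorphism. Finite structures are $\omega$-categorical.) Operators: for a function clone $\mathscr{A}$ on $A$, $\mathsf{P}\mathscr{A}$ (resp. $\mathsf{P}_{\mathrm{fin}}\mathscr{A}$) consists of the componentwise actions of $\mathscr{A}$ on powers $A^I$ with $I$ a nonempty set (resp. a nonempty finite set). For a function clone $\mathscr{C}$ on $C$, $\mathsf{R}\mathscr{C}$ consists of the reflections of $\mathscr{C}$: given a set $B$ and maps $h_1\colon B\to C$, $h_2\colon C\to B$, the reflection is the set of operations $(x_1,\dots,x_n)\mapsto h_2(f(h_1(x_1),\dots,h_1(x_n)))$ on $B$, for $f\in\mathscr{C}$. $\mathsf{E}$ of a set of operations is the collection of all sets of operations on the same domain containing it. All operators are understood up to renaming of elements of domains and act on classes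 memberwise. h1 clone homomorphism: an arity-preserving map $\xi\colon\mathscr{A}\to\mathscr{B}$ with $\xi(f(\pi^m_{i_1},\dots,\pi^m_{i_n}))=\xi(f)(\pi^m_{i_1},\dots,\pi^m_{i_n})$ for all $n,m\ge1$, all $i_1,\dots,i_n\in\{1,\dots,m\}$ and all $n$-ary $f\in\mathscr{A}$. *)

theory Defs
  imports
    Main
    "HOL-Library.FuncSet"
    "HOL-Library.Countable_Set"
    "HOL-Library.Infinite_Typeclass"
begin

section \<open>Relational structures\<close>

text \<open>Tuples are lists, with coordinates counted from 0.\<close>

definition tuples :: "'a set \<Rightarrow> nat \<Rightarrow> 'a list set" where
  "tuples A n = {xs. length xs = n \<and> set xs \<subseteq> A}"

text \<open>The signature of a structure is the set \<open>symbols\<close> together with the restriction of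
  \<open>arity\<close> to it; it may be infinite. The values of \<open>arity\<close> and \<open>interp\<close>
  at other elements of \<open>'s\<close> are irrelevant, so structures are compared by
  \<open>isomorphic\<close>, never by equality.\<close>

record ('a, 's) rel_structure =
  dom_set :: "'a set"
  symbols :: "'s set"
  arity :: "'s \<Rightarrow> nat"
  interp :: "'s \<Rightarrow> 'a list set"

definition is_structure :: "('a, 's) rel_structure \<Rightarrow> bool" where
  "is_structure M \<longleftrightarrow> dom_set M \<noteq> {} \<and>
     (\<forall>R\<in>symbols M. interp M R \<subseteq> tuples (dom_set M) (arity M R))"

definition same_signature :: "('a, 's) rel_structure \<Rightarrow> ('b, 's) rel_structure \<Rightarrow> bool" where
  "same_signature M N \<longleftrightarrow> symbols M = symbols N \<and> (\<forall>R\<in>symbols M. arity M R = arity N R)"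

definition homomorphism ::
  "('a, 's) rel_structure \<Rightarrow> ('b, 's) rel_structure \<Rightarrow> ('a \<Rightarrow> 'b) \<Rightarrow> bool" where
  "homomorphism M N h \<longleftrightarrow> h \<in> dom_set M \<rightarrow> dom_set N \<and>
     (\<forall>R\<in>symbols M. \<forall>t\<in>interp M R. map h t \<in> interp N R)"

definition hom_equivalent :: "('a, 's) rel_structure \<Rightarrow> ('b, 's) rel_structure \<Rightarrow> bool" where
  "hom_equivalent M N \<longleftrightarrow> same_signature M N \<and>
     (\<exists>h. homomorphism M N h) \<and> (\<exists>h. homomorphism N M h)"

definition isomorphism ::
  "('a, 's) rel_structure \<Rightarrow> ('b, 's) rel_structure \<Rightarrow> ('a \<Rightarrow> 'b) \<Rightarrow> bool" where
  "isomorphism M N h \<longleftrightarrow> same_signature M N \<and> bij_betw h (dom_set M) (dom_set N) \<and>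
     (\<forall>R\<in>symbols M. \<forall>t\<in>tuples (dom_set M) (arity M R).
        t \<in> interp M R \<longleftrightarrow> map h t \<in> interp N R)"

definition isomorphic :: "('a, 's) rel_structure \<Rightarrow> ('b, 's) rel_structure \<Rightarrow> bool" where
  "isomorphic M N \<longleftrightarrow> (\<exists>h. isomorphism M N h)"


section \<open>First-order and primitive positive formulas\<close>

datatype 's fo_formula =
    Atom 's "nat list"
  | Equal nat nat
  | Neg "'s fo_formula"
  | Conj "'s fo_formula" "'s fo_formula"
  | Exists nat "'s fo_formula"

primrec free_vars :: "'s fo_formula \<Rightarrow> nat set" where
  "free_vars (Atom R xs) = set xs"
| "free_vars (Equal x y) = {x, y}"
| "free_vars (Neg \<phi>) = free_vars \<phi>"
| "free_vars (Conj \<phi> \<psi>) = free_vars \<phi> \<union> free_vars \<psi>"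
| "free_vars (Exists x \<phi>) = free_vars \<phi> - {x}"

primrec formula_over :: "('a, 's) rel_structure \<Rightarrow> 's fo_formula \<Rightarrow> bool" where
  "formula_over M (Atom R xs) \<longleftrightarrow> R \<in> symbols M \<and> length xs = arity M R"
| "formula_over M (Equal x y) \<longleftrightarrow> True"
| "formula_over M (Neg \<phi>) \<longleftrightarrow> formula_over M \<phi>"
| "formula_over M (Conj \<phi> \<psi>) \<longleftrightarrow> formula_over M \<phi> \<and> formula_over M \<psi>"
| "formula_over M (Exists x \<phi>) \<longleftrightarrow> formula_over M \<phi>"

primrec pp_formula :: "'s fo_formula \<Rightarrow> bool" where
  "pp_formula (Atom R xs) \<longleftrightarrow> True"
| "pp_formula (Equal x y) \<longleftrightarrow> True"
| "pp_formula (Neg \<phi>) \<longleftrightarrow> False"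
| "pp_formula (Conj \<phi> \<psi>) \<longleftrightarrow> pp_formula \<phi> \<and> pp_formula \<psi>"
| "pp_formula (Exists x \<phi>) \<longleftrightarrow> pp_formula \<phi>"

primrec sat :: "('a, 's) rel_structure \<Rightarrow> (nat \<Rightarrow> 'a) \<Rightarrow> 's fo_formula \<Rightarrow> bool" where
  "sat M v (Atom R xs) \<longleftrightarrow> map v xs \<in> interp M R"
| "sat M v (Equal x y) \<longleftrightarrow> v x = v y"
| "sat M v (Neg \<phi>) \<longleftrightarrow> \<not> sat M v \<phi>"
| "sat M v (Conj \<phi> \<psi>) \<longleftrightarrow> sat M v \<phi> \<and> sat M v \<psi>"
| "sat M v (Exists x \<phi>) \<longleftrightarrow> (\<exists>a\<in>dom_set M. sat M (v(x := a)) \<phi>)"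

text \<open>The empty relation is counted as pp-definable. Variable \<open>i\<close> denotes the
  coordinate \<open>t ! i\<close> of the tuple; the bound on the free variables makes the values of
  \<open>(!) t\<close> beyond the length of \<open>t\<close> irrelevant.\<close>

definition pp_definable :: "('a, 's) rel_structure \<Rightarrow> nat \<Rightarrow> 'a list set \<Rightarrow> bool" where
  "pp_definable M k S \<longleftrightarrow> S = {} \<or>
     (\<exists>\<phi>. pp_formula \<phi> \<and> formula_over M \<phi> \<and> free_vars \<phi> \<subseteq> {..<k} \<and>
          S = {t \<in> tuples (dom_set M) k. sat M ((!) t) \<phi>})"


section \<open>pp-powers and pp-interpretations\<close>

text \<open>Flattening by \<open>concat\<close> turns a $k$-ary relation on $A^n$ into a $kn$-ary
  relation on $A$.\<close>

definition pp_power :: "('a, 's) rel_structure \<Rightarrow> ('c, 't) rel_structure \<Rightarrow> bool" where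
  "pp_power A C \<longleftrightarrow> is_structure C \<and>
     (\<exists>n\<ge>1. \<exists>D :: ('a list, 't) rel_structure.
        is_structure D \<and> dom_set D = tuples (dom_set A) n \<and>
        (\<forall>R\<in>symbols D. pp_definable A (arity D R * n) (concat ` interp D R)) \<and>
        isomorphic C D)"

definition flat_preimage ::
  "('a list \<Rightarrow> 'c) \<Rightarrow> 'a list set \<Rightarrow> nat \<Rightarrow> 'c list set \<Rightarrow> 'a list set" where
  "flat_preimage f X k S = concat ` {ts \<in> tuples X k. map f ts \<in> S}"

definition pp_interprets :: "('a, 's) rel_structure \<Rightarrow> ('c, 't) rel_structure \<Rightarrow> bool" where
  "pp_interprets A C \<longleftrightarrow>
     (\<exists>n\<ge>1. \<exists>X f. X \<subseteq> tuples (dom_set A) n \<and> f ` X = dom_set C \<and>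
        pp_definable A n X \<and>
        pp_definable A (2 * n) (flat_preimage f X 2 {[c, c] |c. c \<in> dom_set C}) \<and>
        (\<forall>R\<in>symbols C.
           pp_definable A (arity C R * n) (flat_preimage f X (arity C R) (interp C R))))"


section \<open>pp-constructions\<close>

text \<open>Every at most countable structure has an isomorphic copy on a set of natural numbers, so
  it suffices to compare with structures of element type \<open>nat\<close>.\<close>

definition elementarily_equivalent ::
  "('a, 's) rel_structure \<Rightarrow> ('b, 's) rel_structure \<Rightarrow> bool" where
  "elementarily_equivalent M N \<longleftrightarrow> same_signature M N \<and>
     (\<forall>\<phi>. formula_over M \<phi> \<and> free_vars \<phi> = {} \<longrightarrow>
        (\<forall>v w. range v \<subseteq> dom_set M \<and> range w \<subseteq> dom_set N \<longrightarrow> (sat M v \<phi> \<longleftrightarrow> sat N w \<phi>)))"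

definition omega_categorical :: "('a, 's) rel_structure \<Rightarrow> bool" where
  "omega_categorical M \<longleftrightarrow> countable (dom_set M) \<and>
     (\<forall>N :: (nat, 's) rel_structure.
        is_structure N \<and> elementarily_equivalent M N \<longrightarrow> isomorphic M N)"

definition model_complete_core :: "('a, 's) rel_structure \<Rightarrow> bool" where
  "model_complete_core M \<longleftrightarrow>
     (\<forall>e F. homomorphism M M e \<and> finite F \<and> F \<subseteq> dom_set M \<longrightarrow>
        (\<exists>\<alpha>. isomorphism M M \<alpha> \<and> (\<forall>x\<in>F. \<alpha> x = e x)))"

definition singleton_expansion ::
  "('a, 's) rel_structure \<Rightarrow> ('a, 's) rel_structure \<Rightarrow> bool" where
  "singleton_expansion M N \<longleftrightarrow> dom_set N = dom_set M \<and>
     (\<exists>c a. c \<notin> symbols M \<and> a \<in> dom_set M \<and> symbols N = insert c (symbols M) \<and>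
        (\<forall>R\<in>symbols M. arity N R = arity M R \<and> interp N R = interp M R) \<and>
        arity N c = 1 \<and> interp N c = {[a]})"

definition pp_construction_step ::
  "('u, 's) rel_structure \<Rightarrow> ('u, 's) rel_structure \<Rightarrow> bool" where
  "pp_construction_step C D \<longleftrightarrow> is_structure C \<and> is_structure D \<and>
     (pp_interprets C D \<or> hom_equivalent C D \<or>
      omega_categorical C \<and> model_complete_core C \<and> singleton_expansion C D)"

text \<open>The intermediate structures may be infinite, of any cardinality. HOL cannot quantify over
  types inside a definition, so their domains are taken to be subsets of a universe type
  \<open>'u\<close>, which is a parameter of the notion; the given structures enter and leave the
  chain through isomorphic copies in that universe.\<close>

definition pp_constructible ::
  "'u itself \<Rightarrow> ('a, 's) rel_structure \<Rightarrow> ('b, 's) rel_structure \<Rightarrow> bool" where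
  "pp_constructible U A B \<longleftrightarrow>
     (\<exists>A' B' :: ('u, 's) rel_structure. is_structure A' \<and> is_structure B' \<and>
        isomorphic A A' \<and> pp_construction_step\<^sup>*\<^sup>* A' B' \<and> isomorphic B' B)"


section \<open>Function clones\<close>

text \<open>An operation carries its arity explicitly. Its function is extensional (equal to
  \<open>undefined\<close> outside the tuples of that length), so that equality of operations on a
  set is equality in HOL.\<close>

type_synonym 'a operation = "nat \<times> ('a list \<Rightarrow> 'a)"

definition operations :: "'a set \<Rightarrow> 'a operation set" where
  "operations A = {(n, f). n \<ge> 1 \<and> f \<in> tuples A n \<rightarrow>\<^sub>E A}"

definition projection :: "'a set \<Rightarrow> nat \<Rightarrow> nat \<Rightarrow> 'a operation" where
  "projection A m i = (m, \<lambda>xs\<in>tuples A m. xs ! i)"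

definition compose_op ::
  "'a set \<Rightarrow> nat \<Rightarrow> 'a operation \<Rightarrow> 'a operation list \<Rightarrow> 'a operation" where
  "compose_op A m f gs = (m, \<lambda>xs\<in>tuples A m. snd f (map (\<lambda>g. snd g xs) gs))"

definition function_clone :: "'a set \<Rightarrow> 'a operation set \<Rightarrow> bool" where
  "function_clone A F \<longleftrightarrow> A \<noteq> {} \<and> F \<subseteq> operations A \<and>
     (\<forall>m\<ge>1. \<forall>i<m. projection A m i \<in> F) \<and>
     (\<forall>m\<ge>1. \<forall>f\<in>F. \<forall>gs. length gs = fst f \<and> set gs \<subseteq> F \<and> (\<forall>g\<in>set gs. fst g = m) \<longrightarrow>
        compose_op A m f gs \<in> F)"

definition preserves :: "'a operation \<Rightarrow> nat \<Rightarrow> 'a list set \<Rightarrow> bool" where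
  "preserves f k S \<longleftrightarrow>
     (\<forall>ts\<in>tuples S (fst f). map (\<lambda>j. snd f (map (\<lambda>t. t ! j) ts)) [0..<k] \<in> S)"

definition Pol :: "('a, 's) rel_structure \<Rightarrow> 'a operation set" where
  "Pol M = {f \<in> operations (dom_set M). \<forall>R\<in>symbols M. preserves f (arity M R) (interp M R)}"

lemma function_clone_Pol:
  assumes "is_structure M"
  shows "function_clone (dom_set M) (Pol M)"
proof -
  let ?A = "dom_set M"
  have rel: "t \<in> tuples ?A (arity M R)" if "R \<in> symbols M" "t \<in> interp M R" for R t
    using assms that by (auto simp: is_structure_def)
  have cols: "map (\<lambda>t. t ! j) ts \<in> tuples ?A n"
    if "R \<in> symbols M" "ts \<in> tuples (interp M R) n" "j < arity M R" for R ts n j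
    using rel[OF that(1)] that by (force simp: tuples_def)
  have "?A \<noteq> {}" using assms by (simp add: is_structure_def)
  moreover have "Pol M \<subseteq> operations ?A" by (auto simp: Pol_def)
  moreover have "projection ?A m i \<in> Pol M" if "1 \<le> m" "i < m" for m i
  proof -
    have "preserves (projection ?A m i) (arity M R) (interp M R)" if R: "R \<in> symbols M" for R
      unfolding preserves_def
    proof
      fix ts assume "ts \<in> tuples (interp M R) (fst (projection ?A m i))"
      then have ts: "ts \<in> tuples (interp M R) m" by (simp add: projection_def)
      with \<open>i < m\<close> have ti: "ts ! i \<in> interp M R" by (auto simp: tuples_def)
      have "map (\<lambda>j. snd (projection ?A m i) (map (\<lambda>t. t ! j) ts)) [0..<arity M R] = ts ! i"
        using rel[OF R ti] cols[OF R ts] ts \<open>i < m\<close>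
        by (intro nth_equalityI) (auto simp: tuples_def projection_def)
      with ti show "map (\<lambda>j. snd (projection ?A m i) (map (\<lambda>t. t ! j) ts)) [0..<arity M R]
        \<in> interp M R" by simp
    qed
    moreover have "projection ?A m i \<in> operations ?A"
      using that by (auto simp: operations_def projection_def tuples_def)
    ultimately show ?thesis by (simp add: Pol_def)
  qed
  moreover have "compose_op ?A m f gs \<in> Pol M"
    if m: "1 \<le> m" and f: "f \<in> Pol M" and len: "length gs = fst f"
      and gs: "set gs \<subseteq> Pol M" "\<forall>g\<in>set gs. fst g = m" for m f gs
  proof -
    have g: "snd g \<in> tuples ?A m \<rightarrow> ?A" if "g \<in> set gs" for g
      using that gs by (fastforce simp: Pol_def operations_def)
    have f': "snd f \<in> tuples ?A (fst f) \<rightarrow> ?A"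
      using f by (auto simp: Pol_def operations_def)
    have args: "map (\<lambda>g. snd g xs) gs \<in> tuples ?A (fst f)" if "xs \<in> tuples ?A m" for xs
      using g len that by (auto simp: tuples_def)
    have "preserves (compose_op ?A m f gs) (arity M R) (interp M R)" if R: "R \<in> symbols M" for R
      unfolding preserves_def
    proof
      fix ts assume "ts \<in> tuples (interp M R) (fst (compose_op ?A m f gs))"
      then have ts: "ts \<in> tuples (interp M R) m" by (simp add: compose_op_def)
      define us where
        "us = map (\<lambda>g. map (\<lambda>j. snd g (map (\<lambda>t. t ! j) ts)) [0..<arity M R]) gs"
      have "us \<in> tuples (interp M R) (fst f)"
        using gs ts R len by (auto simp: us_def tuples_def Pol_def preserves_def subset_iff)
      then have "map (\<lambda>j. snd f (map (\<lambda>t. t ! j) us)) [0..<arity M R] \<in> interp M R"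
        using f R by (auto simp: Pol_def preserves_def)
      also have "map (\<lambda>j. snd f (map (\<lambda>t. t ! j) us)) [0..<arity M R] =
        map (\<lambda>j. snd (compose_op ?A m f gs) (map (\<lambda>t. t ! j) ts)) [0..<arity M R]"
        using cols[OF R ts] by (simp add: compose_op_def us_def comp_def)
      finally show "map (\<lambda>j. snd (compose_op ?A m f gs) (map (\<lambda>t. t ! j) ts)) [0..<arity M R]
        \<in> interp M R" .
    qed
    moreover have "compose_op ?A m f gs \<in> operations ?A"
      using m f' args by (auto simp: operations_def compose_op_def)
    ultimately show ?thesis by (simp add: Pol_def)
  qed
  ultimately show ?thesis unfolding function_clone_def by blast
qed

text \<open>An h1 clone homomorphism preserves composition with projections.\<close>

definition h1_clone_homomorphism ::
  "'a set \<Rightarrow> 'a operation set \<Rightarrow> 'b set \<Rightarrow> 'b operation set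
   \<Rightarrow> ('a operation \<Rightarrow> 'b operation) \<Rightarrow> bool" where
  "h1_clone_homomorphism A F B G \<xi> \<longleftrightarrow>
     (\<forall>f\<in>F. \<xi> f \<in> G \<and> fst (\<xi> f) = fst f) \<and>
     (\<forall>f\<in>F. \<forall>m\<ge>1. \<forall>is\<in>tuples {..<m} (fst f).
        \<xi> (compose_op A m f (map (projection A m) is)) =
        compose_op B m (\<xi> f) (map (projection B m) is))"


section \<open>The operators E, R, P\<close>

text \<open>A set of operations is paired with its domain. The operators act on classes of such
  pairs. Since \<open>R_op\<close> ranges over all sets \<open>B\<close> and all maps between the two
  domains, \<open>R_op K\<close> is closed under renaming of elements and does not change when the
  members of \<open>K\<close> are renamed; the powers are therefore left on their natural domain of
  functions on the index set. The index sets are subsets of a type \<open>'i\<close>.\<close>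

type_synonym 'a algebra = "'a set \<times> 'a operation set"

definition power_algebra :: "'i set \<Rightarrow> 'a algebra \<Rightarrow> ('i \<Rightarrow> 'a) algebra" where
  "power_algebra I \<A> =
     (let A = fst \<A>; P = I \<rightarrow>\<^sub>E A in
      (P, (\<lambda>(n, f). (n, \<lambda>xs\<in>tuples P n. \<lambda>i\<in>I. f (map (\<lambda>x. x i) xs))) ` snd \<A>))"

definition P_op :: "'i itself \<Rightarrow> 'a algebra set \<Rightarrow> ('i \<Rightarrow> 'a) algebra set" where
  "P_op T K = {power_algebra I \<A> |I \<A>. I \<noteq> {} \<and> \<A> \<in> K}"

definition Pfin_op :: "'i itself \<Rightarrow> 'a algebra set \<Rightarrow> ('i \<Rightarrow> 'a) algebra set" where
  "Pfin_op T K = {power_algebra I \<A> |I \<A>. I \<noteq> {} \<and> finite I \<and> \<A> \<in> K}"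

definition reflection ::
  "'b set \<Rightarrow> ('b \<Rightarrow> 'c) \<Rightarrow> ('c \<Rightarrow> 'b) \<Rightarrow> 'c algebra \<Rightarrow> 'b algebra" where
  "reflection B h1 h2 \<C> =
     (B, (\<lambda>(n, f). (n, \<lambda>xs\<in>tuples B n. h2 (f (map h1 xs)))) ` snd \<C>)"

definition R_op :: "'c algebra set \<Rightarrow> 'b algebra set" where
  "R_op K = {reflection B h1 h2 \<C> |B h1 h2 \<C>.
     \<C> \<in> K \<and> h1 \<in> B \<rightarrow> fst \<C> \<and> h2 \<in> fst \<C> \<rightarrow> B}"

definition E_op :: "'b algebra set \<Rightarrow> 'b algebra set" where
  "E_op K = {(B, G). G \<subseteq> operations B \<and> (\<exists>F. (B, F) \<in> K \<and> F \<subseteq> G)}"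

end

theory Submission
  imports Defs
begin

text \<open>All conditions are compared with (iii).

  One shape of map produces all the h1 clone homomorphisms needed: take a power $A^J$, maps
  $p\colon C\to A^J$ and $q\colon A^J\to C$, and send $f$ to
  $(c_1,\dots,c_n)\mapsto q(f(p(c_1),\dots,p(c_n)))$, with $f$ acting on $A^J$ componentwise
  (\<open>power_reflect\<close>). Permuting, identifying or adding variables commutes with this formula,
  so it always gives an h1 clone homomorphism (\<open>h1_power_reflect\<close>) once its values lie in the
  target clone. For a homomorphic equivalence $J$ is a singleton and $p$, $q$ are the two
  homomorphisms; for a pp-interpretation $J$ indexes the coordinates, $q$ is the interpreting map
  and $p$ a section of it, and the values are polymorphisms because polymorphisms preserve
  pp-definable relations; condition (ii') is this shape literally. A pp-power is a special
  pp-interpretation. Hence (i), (ii) and (ii') imply (iii).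

  Adding a constant $a$ to a model-complete core $\mathbb{C}$ is the only construction of another
  kind. When $C$ is finite, the diagonal $x\mapsto f(x,\dots,x)$ of a polymorphism is an
  automorphism; composing $f$ with its inverse gives an idempotent operation, which fixes $a$, and
  this is an h1 clone homomorphism because a minor has the same diagonal
  (\<open>singleton_expansion_h1\<close>). Structures in a chain of constructions may be infinite, even when
  the chain starts from a finite one; but they all keep an endomorphism with finite image, and a
  model-complete core with such an endomorphism is finite since its endomorphisms are injective
  (\<open>finite_model_complete_core\<close>). So (i') implies (iii).

  Conversely, an h1 clone homomorphism $\xi$ gives (ii) by a free-algebra argument
  (\<open>h1_E_R_Pfin_op\<close>): with $N=|B|$, send the $i$-th element of $B$ to the $i$-th $N$-ary projection,
  a point of the finite power $A^{A^N}$, and send an $N$-ary polymorphism $g$, another such point,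
  to $\xi(g)(b_1,\dots,b_N)$. The reflection along these maps is $\xi$ itself.

  For (ii) to (i), let $p\colon B\to A^n$ and $q\colon A^n\to B$ be the maps of the reflection, and
  let $\mathbb{D}$ have on $A^n$, for every relation $R$ of $\mathbb{B}$, the closure of $p(R)$ under
  the polymorphisms of $\mathbb{A}$. Then $p$ is a homomorphism by construction and $q$ is one because
  the reflected operations preserve $R$ (\<open>finite_power_reflection_pp_power\<close>). The relations of
  $\mathbb{D}$ are pp-definable because over a finite structure the closure of any finite set of
  tuples is (\<open>pp_definable_generated\<close>, the classical theorem of Geiger and of Bodnarchuk, Kaluzhnin,
  Kotov and Romov).
  Finally, the same passage from (iii) to a pp-power, carried out for copies of $\mathbb{A}$ and
  $\mathbb{B}$ in the universe of the construction chains, gives the chain of two steps that proves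
  (i') (\<open>pp_constructible_iff_h1\<close>).\<close>


section \<open>Operations acting on tuples\<close>

definition act :: "'a operation \<Rightarrow> nat \<Rightarrow> 'a list list \<Rightarrow> 'a list" where
  "act f k ts = map (\<lambda>j. snd f (map (\<lambda>t. t ! j) ts)) [0..<k]"

lemma length_act [simp]: "length (act f k ts) = k"
  by (simp add: act_def)

lemma nth_act [simp]: "j < k \<Longrightarrow> act f k ts ! j = snd f (map (\<lambda>t. t ! j) ts)"
  by (simp add: act_def)

lemma preserves_iff_act:
  "preserves f k S \<longleftrightarrow> (\<forall>ts\<in>tuples S (fst f). act f k ts \<in> S)"
  by (simp add: preserves_def act_def)

lemma tuples_mono: "S \<subseteq> T \<Longrightarrow> tuples S n \<subseteq> tuples T n"
  by (auto simp: tuples_def)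

lemma finite_tuples: "finite A \<Longrightarrow> finite (tuples A n)"
  using finite_lists_length_eq[of A n] by (simp add: tuples_def conj_commute)

lemma map_in_tuples:
  "ts \<in> tuples S n \<Longrightarrow> (\<And>t. t \<in> S \<Longrightarrow> h t \<in> T) \<Longrightarrow> map h ts \<in> tuples T n"
  by (auto simp: tuples_def)

lemma column_in_tuples:
  "ts \<in> tuples (tuples A k) n \<Longrightarrow> j < k \<Longrightarrow> map (\<lambda>t. t ! j) ts \<in> tuples A n"
  by (erule map_in_tuples) (auto simp: tuples_def)

lemma operation_closed: "f \<in> operations A \<Longrightarrow> xs \<in> tuples A (fst f) \<Longrightarrow> snd f xs \<in> A"
  by (auto simp: operations_def)

lemma operation_eqI:
  assumes "f \<in> operations A" "g \<in> operations A" "fst f = fst g"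
    and "\<And>xs. xs \<in> tuples A (fst f) \<Longrightarrow> snd f xs = snd g xs"
  shows "f = g"
proof (rule prod_eqI)
  show "snd f = snd g"
    using assms by (intro PiE_ext[of _ "tuples A (fst f)" "\<lambda>_. A"]) (auto simp: operations_def)
qed (fact assms)

lemma act_in_tuples:
  "f \<in> operations A \<Longrightarrow> ts \<in> tuples (tuples A k) (fst f) \<Longrightarrow> act f k ts \<in> tuples A k"
  using operation_closed[OF _ column_in_tuples[of ts A k "fst f"]]
  by (auto simp: act_def tuples_def[of A k])

lemma interp_subset_tuples:
  "is_structure M \<Longrightarrow> R \<in> symbols M \<Longrightarrow> interp M R \<subseteq> tuples (dom_set M) (arity M R)"
  by (simp add: is_structure_def)

lemma Pol_operation: "f \<in> Pol M \<Longrightarrow> f \<in> operations (dom_set M)"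
  by (simp add: Pol_def)

lemma Pol_arity_pos: "f \<in> Pol M \<Longrightarrow> 1 \<le> fst f"
  by (auto simp: Pol_def operations_def)

lemma PolI:
  assumes "f \<in> operations (dom_set M)"
    and "\<And>R ts. R \<in> symbols M \<Longrightarrow> ts \<in> tuples (interp M R) (fst f) \<Longrightarrow>
      act f (arity M R) ts \<in> interp M R"
  shows "f \<in> Pol M"
  using assms by (auto simp: Pol_def preserves_iff_act)

lemma Pol_act:
  "f \<in> Pol M \<Longrightarrow> R \<in> symbols M \<Longrightarrow> ts \<in> tuples (interp M R) (fst f) \<Longrightarrow>
    act f (arity M R) ts \<in> interp M R"
  by (auto simp: Pol_def preserves_iff_act)

text \<open>A tuple over $A^n$ is flattened by \<open>concat\<close>. The following facts say that the componentwise
  action of an operation commutes with flattening, and that flattening loses nothing when all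
  blocks have the same length.\<close>

lemma nth_concat_uniform:
  "\<forall>t\<in>set ts. length t = n \<Longrightarrow> i < length ts * n \<Longrightarrow>
    concat ts ! i = ts ! (i div n) ! (i mod n)"
proof (induction ts arbitrary: i)
  case (Cons t ts)
  then have n: "0 < n" by (cases n) auto
  show ?case
  proof (cases "i < n")
    case True
    with Cons.prems show ?thesis by (simp add: nth_append)
  next
    case False
    then have "i div n = Suc ((i - n) div n)" "i mod n = (i - n) mod n"
      using n by (simp_all add: le_div_geq le_mod_geq)
    with False Cons show ?thesis by (simp add: nth_append)
  qed
qed simp

lemma length_concat_uniform:
  "\<forall>t\<in>set ts. length t = n \<Longrightarrow> length (concat ts) = length ts * n"
  by (induction ts) auto

lemma act_concat:
  assumes "\<forall>ts\<in>set tss. length ts = k \<and> (\<forall>t\<in>set ts. length t = n)"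
  shows "act f (k * n) (map concat tss) =
    concat (map (\<lambda>j. act f n (map (\<lambda>ts. ts ! j) tss)) [0..<k])" (is "?l = concat ?r")
proof (rule nth_equalityI)
  have r: "\<forall>t\<in>set ?r. length t = n" by simp
  from length_concat_uniform[OF this] show len: "length ?l = length (concat ?r)" by simp
  fix i assume "i < length ?l"
  then have i: "i < k * n" by simp
  then have n: "0 < n" by (cases n) auto
  have d: "i div n < k" using i by (simp add: less_mult_imp_div_less)
  have "?l ! i = snd f (map (\<lambda>ts. concat ts ! i) tss)" using i by (simp add: comp_def)
  also have "map (\<lambda>ts. concat ts ! i) tss = map (\<lambda>ts. ts ! (i div n) ! (i mod n)) tss"
    using assms i by (auto intro!: nth_concat_uniform)
  also have "snd f \<dots> = concat ?r ! i"
    using i d n nth_concat_uniform[OF r, of i] by (simp add: comp_def)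
  finally show "?l ! i = concat ?r ! i" .
qed

lemma concat_uniform_inject:
  assumes "concat us = concat vs" "length us = length vs"
    and "\<forall>u\<in>set us. length u = n" "\<forall>v\<in>set vs. length v = n"
  shows "us = vs"
proof (rule concat_injective[OF assms(1,2)])
  have "length u = length v" if "(u, v) \<in> set (zip us vs)" for u v
    using set_zip_leftD[OF that] set_zip_rightD[OF that] assms(3,4) by simp
  then show "\<forall>(u, v)\<in>set (zip us vs). length u = length v" by blast
qed

lemma map_column:
  "ts \<in> tuples (tuples A k) n \<Longrightarrow> j < k \<Longrightarrow>
    map (\<lambda>t. t ! j) (map (map h) ts) = map h (map (\<lambda>t. t ! j) ts)"
  by (auto simp: tuples_def)

lemma act_map:
  assumes "ts \<in> tuples (tuples A k) n"
  shows "act f k (map (map h) ts) = map (\<lambda>j. snd f (map h (map (\<lambda>t. t ! j) ts))) [0..<k]"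
  unfolding act_def by (intro map_cong refl) (subst map_column[OF assms], auto)

lemma act_projection:
  assumes "ts \<in> tuples (tuples A k) m" "i < m"
  shows "act (projection A m i) k ts = ts ! i"
proof (rule nth_equalityI)
  have "ts ! i \<in> set ts" using assms by (simp add: tuples_def)
  then show "length (act (projection A m i) k ts) = length (ts ! i)"
    using assms(1) by (auto simp: tuples_def)
  fix j assume "j < length (act (projection A m i) k ts)"
  then show "act (projection A m i) k ts ! j = ts ! i ! j"
    using assms column_in_tuples[OF assms(1), of j]
    by (auto simp: projection_def tuples_def[of "tuples A k"])
qed

lemma restrict_operation:
  assumes "1 \<le> n" "\<And>cs. cs \<in> tuples C n \<Longrightarrow> F cs \<in> C"
  shows "(n, \<lambda>cs\<in>tuples C n. F cs) \<in> operations C"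
  using assms by (auto simp: operations_def)

lemma act_restrict:
  "ts \<in> tuples (tuples C k) n \<Longrightarrow>
    act (n, \<lambda>cs\<in>tuples C n. F cs) k ts = map (\<lambda>j. F (map (\<lambda>t. t ! j) ts)) [0..<k]"
  using column_in_tuples[of ts C k n] by (simp add: act_def)

text \<open>The operations built below are all given by a term restricted to the tuples of the right
  length; the restriction is dealt with here once, so that later only the term matters.\<close>

lemma restrict_in_Pol:
  assumes M: "is_structure M" and n: "1 \<le> n"
    and cl: "\<And>cs. cs \<in> tuples (dom_set M) n \<Longrightarrow> F cs \<in> dom_set M"
    and R: "\<And>R ts. R \<in> symbols M \<Longrightarrow> ts \<in> tuples (interp M R) n \<Longrightarrow>
      ts \<in> tuples (tuples (dom_set M) (arity M R)) n \<Longrightarrow>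
      map (\<lambda>j. F (map (\<lambda>t. t ! j) ts)) [0..<arity M R] \<in> interp M R"
  shows "(n, \<lambda>cs\<in>tuples (dom_set M) n. F cs) \<in> Pol M"
proof (rule PolI)
  show "(n, \<lambda>cs\<in>tuples (dom_set M) n. F cs) \<in> operations (dom_set M)"
    using n cl by (rule restrict_operation)
  fix R ts assume "R \<in> symbols M" "ts \<in> tuples (interp M R) (fst (n, \<lambda>cs\<in>tuples (dom_set M) n. F cs))"
  moreover from this have "ts \<in> tuples (tuples (dom_set M) (arity M R)) n"
    using tuples_mono[OF interp_subset_tuples[OF M]] by fastforce
  ultimately show "act (n, \<lambda>cs\<in>tuples (dom_set M) n. F cs) (arity M R) ts \<in> interp M R"
    using R by (simp add: act_restrict)
qed


section \<open>Polymorphisms and primitive positive definability\<close>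

text \<open>Polymorphisms act on satisfying valuations: atoms are preserved by definition, and a witness for
  an existential quantifier is obtained by applying the operation to the given witnesses. The
  valuations are constrained on the free variables only, since \<open>(!) t\<close> is arbitrary beyond the
  length of \<open>t\<close>.\<close>

lemma pp_sat_act:
  assumes f: "f \<in> Pol M"
  shows "\<lbrakk>pp_formula \<phi>; formula_over M \<phi>; length vs = fst f;
    \<forall>v\<in>set vs. sat M v \<phi> \<and> v ` free_vars \<phi> \<subseteq> dom_set M;
    \<forall>x\<in>free_vars \<phi>. w x = snd f (map (\<lambda>v. v x) vs)\<rbrakk> \<Longrightarrow> sat M w \<phi>"
proof (induction \<phi> arbitrary: vs w)
  case (Atom R xs)
  let ?ts = "map (\<lambda>v. map v xs) vs"
  have "?ts \<in> tuples (interp M R) (fst f)" using Atom.prems by (auto simp: tuples_def)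
  with f have "act f (arity M R) ?ts \<in> interp M R" using Atom.prems by (auto intro: Pol_act)
  also have "act f (arity M R) ?ts = map w xs"
    using Atom.prems by (intro nth_equalityI) (auto simp: comp_def)
  finally show ?case by simp
next
  case (Equal x y)
  then have "map (\<lambda>v. v x) vs = map (\<lambda>v. v y) vs" by auto
  with Equal.prems(5) show ?case by simp
next
  case (Conj \<phi> \<psi>)
  have "sat M w \<phi>" using Conj.prems by (intro Conj.IH(1)[of vs]) auto
  moreover have "sat M w \<psi>" using Conj.prems by (intro Conj.IH(2)[of vs]) auto
  ultimately show ?case by simp
next
  case (Exists x \<phi>)
  have "\<forall>v\<in>set vs. \<exists>a\<in>dom_set M. sat M (v(x := a)) \<phi>" using Exists.prems by simp
  then obtain a where a: "\<forall>v\<in>set vs. a v \<in> dom_set M \<and> sat M (v(x := a v)) \<phi>" by metis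
  let ?b = "snd f (map a vs)"
  have "sat M (w(x := ?b)) \<phi>"
  proof (rule Exists.IH[of "map (\<lambda>v. v(x := a v)) vs"])
    show "\<forall>v\<in>set (map (\<lambda>v. v(x := a v)) vs). sat M v \<phi> \<and> v ` free_vars \<phi> \<subseteq> dom_set M"
      using a Exists.prems(4) by fastforce
    show "\<forall>y\<in>free_vars \<phi>. (w(x := ?b)) y =
        snd f (map (\<lambda>v. v y) (map (\<lambda>v. v(x := a v)) vs))"
      using Exists.prems(5) by (auto simp: comp_def)
  qed (use Exists.prems in auto)
  moreover have "map a vs \<in> tuples (dom_set M) (fst f)"
    using a Exists.prems(3) by (auto simp: tuples_def)
  then have "?b \<in> dom_set M" using f operation_closed Pol_operation by metis
  ultimately show ?case by auto
qed simp

lemma Pol_preserves_pp_definable: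
  assumes f: "f \<in> Pol M" and S: "pp_definable M k S"
  shows "preserves f k S"
  unfolding preserves_iff_act
proof
  fix ts assume ts: "ts \<in> tuples S (fst f)"
  then have "S \<noteq> {}" using Pol_arity_pos[OF f] by (auto simp: tuples_def)
  with S obtain \<phi> where \<phi>: "pp_formula \<phi>" "formula_over M \<phi>" "free_vars \<phi> \<subseteq> {..<k}"
    and S: "S = {t \<in> tuples (dom_set M) k. sat M ((!) t) \<phi>}"
    by (auto simp: pp_definable_def)
  have tsM: "ts \<in> tuples (tuples (dom_set M) k) (fst f)"
    using ts S tuples_mono[of S] by blast
  have "sat M ((!) (act f k ts)) \<phi>"
  proof (rule pp_sat_act[OF f \<phi>(1,2), of "map (!) ts"])
    show "\<forall>v\<in>set (map (!) ts). sat M v \<phi> \<and> v ` free_vars \<phi> \<subseteq> dom_set M"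
      using ts \<phi>(3) unfolding S by (fastforce simp: tuples_def)
    show "\<forall>x\<in>free_vars \<phi>. act f k ts ! x = snd f (map (\<lambda>v. v x) (map (!) ts))"
      using \<phi>(3) by (auto simp: comp_def)
  qed (use ts in \<open>simp add: tuples_def\<close>)
  moreover have "act f k ts \<in> tuples (dom_set M) k"
    using act_in_tuples[OF Pol_operation[OF f] tsM] .
  ultimately show "act f k ts \<in> S" by (simp add: S)
qed

text \<open>The empty conjunction has to be a true formula without free variables, whence the quantifier.\<close>

definition conj_list :: "'s fo_formula list \<Rightarrow> 's fo_formula" where
  "conj_list \<phi>s = foldr Conj \<phi>s (Exists 0 (Equal 0 0))"

definition exists_list :: "nat list \<Rightarrow> 's fo_formula \<Rightarrow> 's fo_formula" where
  "exists_list xs \<phi> = foldr Exists xs \<phi>"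

lemma free_vars_conj_list: "free_vars (conj_list \<phi>s) = (\<Union>\<phi>\<in>set \<phi>s. free_vars \<phi>)"
  by (induction \<phi>s) (auto simp: conj_list_def)

lemma pp_formula_conj_list: "pp_formula (conj_list \<phi>s) \<longleftrightarrow> (\<forall>\<phi>\<in>set \<phi>s. pp_formula \<phi>)"
  by (induction \<phi>s) (auto simp: conj_list_def)

lemma formula_over_conj_list:
  "formula_over M (conj_list \<phi>s) \<longleftrightarrow> (\<forall>\<phi>\<in>set \<phi>s. formula_over M \<phi>)"
  by (induction \<phi>s) (auto simp: conj_list_def)

lemma sat_conj_list:
  "dom_set M \<noteq> {} \<Longrightarrow> sat M v (conj_list \<phi>s) \<longleftrightarrow> (\<forall>\<phi>\<in>set \<phi>s. sat M v \<phi>)"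
  by (induction \<phi>s) (auto simp: conj_list_def)

lemma free_vars_exists_list: "free_vars (exists_list xs \<phi>) = free_vars \<phi> - set xs"
  by (induction xs) (auto simp: exists_list_def)

lemma pp_formula_exists_list: "pp_formula (exists_list xs \<phi>) \<longleftrightarrow> pp_formula \<phi>"
  by (induction xs) (auto simp: exists_list_def)

lemma formula_over_exists_list: "formula_over M (exists_list xs \<phi>) \<longleftrightarrow> formula_over M \<phi>"
  by (induction xs) (auto simp: exists_list_def)

lemma sat_exists_list:
  "sat M v (exists_list xs \<phi>) \<longleftrightarrow>
    (\<exists>w. (\<forall>x\<in>set xs. w x \<in> dom_set M) \<and> (\<forall>x. x \<notin> set xs \<longrightarrow> w x = v x) \<and> sat M w \<phi>)"
proof (induction xs arbitrary: v)
  case Nil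
  have "w = v" if "\<forall>x. w x = v x" for w using that by auto
  then show ?case by (auto simp: exists_list_def)
next
  case (Cons y xs)
  have "sat M v (exists_list (y # xs) \<phi>) \<longleftrightarrow>
      (\<exists>a\<in>dom_set M. sat M (v(y := a)) (exists_list xs \<phi>))"
    by (simp add: exists_list_def)
  also have "\<dots> \<longleftrightarrow> (\<exists>w. (\<forall>x\<in>set (y # xs). w x \<in> dom_set M) \<and>
      (\<forall>x. x \<notin> set (y # xs) \<longrightarrow> w x = v x) \<and> sat M w \<phi>)" (is "?L \<longleftrightarrow> ?R")
  proof
    assume ?L
    then show ?R unfolding Cons.IH by (metis fun_upd_apply set_ConsD list.set_intros(1,2))
  next
    assume ?R
    then obtain w where w: "\<forall>x\<in>set (y # xs). w x \<in> dom_set M"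
      "\<forall>x. x \<notin> set (y # xs) \<longrightarrow> w x = v x" "sat M w \<phi>" by blast
    then show ?L unfolding Cons.IH by (intro bexI[of _ "w y"] exI[of _ w]) auto
  qed
  finally show ?case .
qed

text \<open>Compactness for finitely many candidates: each \<open>x\<close> that fails some condition is excluded by a
  single one. This is what keeps the formula below finite over an infinite signature.\<close>

lemma finite_subfamily_suffices:
  assumes "finite X"
  obtains Q' where "finite Q'" "Q' \<subseteq> Q"
    and "\<And>x. x \<in> X \<Longrightarrow> \<forall>q\<in>Q'. P q x \<Longrightarrow> \<forall>q\<in>Q. P q x"
proof -
  define X' where "X' = {x \<in> X. \<exists>q\<in>Q. \<not> P q x}"
  have "\<forall>x\<in>X'. \<exists>q. q \<in> Q \<and> \<not> P q x" by (auto simp: X'_def)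
  then obtain w where w: "\<forall>x\<in>X'. w x \<in> Q \<and> \<not> P (w x) x"
    by (rule bchoice[THEN exE])
  show thesis
  proof (rule that)
    show "finite (w ` X')" using assms by (simp add: X'_def)
    show "w ` X' \<subseteq> Q" using w by auto
    fix x assume "x \<in> X" "\<forall>q\<in>w ` X'. P q x"
    with w show "\<forall>q\<in>Q. P q x" unfolding X'_def by blast
  qed
qed

text \<open>The relation generated by \<open>rs\<close> under the polymorphisms is pp-definable. An $m$-ary operation on a
  finite set is a finite table, that is, a valuation of variables indexed by the $m$-tuples; to be a
  polymorphism is a conjunction of atomic conditions on this table. The formula therefore says
  that there is a table which satisfies these atoms and whose values at the columns of \<open>rs\<close> are
  the entries of the given tuple.\<close>

lemma pp_definable_generated:
  assumes M: "is_structure M" "finite (dom_set M)"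
    and rs: "rs \<noteq> []" "set rs \<subseteq> tuples (dom_set M) k"
  shows "pp_definable M k {act g k rs |g. g \<in> Pol M \<and> fst g = length rs}"
    (is "pp_definable M k ?S")
proof -
  define A where "A = dom_set M"
  define m where "m = length rs"
  define T where "T = tuples A m"
  have ne: "dom_set M \<noteq> {}" using M by (simp add: is_structure_def)
  have finT: "finite T" using M by (simp add: T_def A_def finite_tuples)
  obtain idx :: "'a list \<Rightarrow> nat" and N where idx: "idx ` T = {i. i < N}" "inj_on idx T"
    using finite_imp_inj_to_nat_seg[OF finT] by metis
  define col where "col j = map (\<lambda>t. t ! j) rs" for j
  have rsT: "rs \<in> tuples (tuples A k) m" using rs by (auto simp: tuples_def m_def A_def)
  then have col: "col j \<in> T" if "j < k" for j
    using that column_in_tuples unfolding col_def T_def by blast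
  \<comment> \<open>Variables below \<open>k\<close> stand for the defined tuple, those from \<open>k\<close> on for table entries.\<close>
  define var where "var xs = k + idx xs" for xs
  have var: "var xs \<in> {k..<k + N}" if "xs \<in> T" for xs
    using idx(1) that by (auto simp: var_def)
  define op where "op w = (m, \<lambda>xs\<in>T. w (var xs))" for w :: "nat \<Rightarrow> 'a"
  \<comment> \<open>One atomic condition for each symbol and each choice of \<open>m\<close> tuples of its relation.\<close>
  define Q where "Q = {(R, ts). R \<in> symbols M \<and> ts \<in> tuples (interp M R) m}"
  define ok where
    "ok q F \<longleftrightarrow> act (m, F) (arity M (fst q)) (snd q) \<in> interp M (fst q)" for q F
  define atom where "atom q =
    Atom (fst q) (map (\<lambda>j. var (map (\<lambda>t. t ! j) (snd q))) [0..<arity M (fst q)])" for q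
  have colT: "map (\<lambda>t. t ! j) ts \<in> T" if "(R, ts) \<in> Q" "j < arity M R" for R ts j
    using that tuples_mono[OF interp_subset_tuples[OF M(1)], of R m] column_in_tuples
    unfolding Q_def T_def A_def by blast
  have sat_atom: "sat M w (atom q) \<longleftrightarrow> ok q (snd (op w))" if "q \<in> Q" for q w
  proof -
    have "act (op w) (arity M (fst q)) (snd q) =
        map w (map (\<lambda>j. var (map (\<lambda>t. t ! j) (snd q))) [0..<arity M (fst q)])"
      using colT[of "fst q" "snd q"] that by (auto simp: act_def op_def)
    moreover have "op w = (m, snd (op w))" by (simp add: op_def)
    ultimately show ?thesis by (simp add: atom_def ok_def)
  qed
  have PolQ: "(m, F) \<in> Pol M \<longleftrightarrow> (\<forall>q\<in>Q. ok q F)" if "F \<in> T \<rightarrow>\<^sub>E A" for F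
  proof -
    have "(m, F) \<in> operations (dom_set M)"
      using that rs by (cases m) (auto simp: operations_def T_def A_def m_def)
    then show ?thesis by (auto simp: Pol_def preserves_iff_act Q_def ok_def)
  qed
  have finX: "finite (T \<rightarrow>\<^sub>E A)" using finT M by (simp add: A_def finite_PiE)
  obtain Q' where Q': "finite Q'" "Q' \<subseteq> Q"
    "\<And>F. F \<in> T \<rightarrow>\<^sub>E A \<Longrightarrow> \<forall>q\<in>Q'. ok q F \<Longrightarrow> \<forall>q\<in>Q. ok q F"
    using finite_subfamily_suffices[OF finX] by metis
  obtain qs where qs: "set qs = Q'" using finite_list[OF Q'(1)] by blast
  \<comment> \<open>The equations read the defined tuple off the table; the atoms make the table a polymorphism.\<close>
  define \<psi> where "\<psi> = Conj (conj_list (map (\<lambda>j. Equal j (var (col j))) [0..<k]))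
    (conj_list (map atom qs))"
  define \<phi> where "\<phi> = exists_list [k..<k + N] \<psi>"
  have "pp_formula \<phi>"
    by (auto simp: \<phi>_def \<psi>_def pp_formula_exists_list pp_formula_conj_list atom_def)
  moreover have "formula_over M \<phi>"
    using Q'(2) qs
    by (auto simp: \<phi>_def \<psi>_def formula_over_exists_list formula_over_conj_list atom_def Q_def)
  moreover have "free_vars \<phi> \<subseteq> {..<k}"
  proof -
    have "free_vars (atom q) \<subseteq> {k..<k + N}" if "q \<in> Q" for q
      using that var colT[of "fst q" "snd q"] by (auto simp: atom_def)
    moreover have "var (col j) \<in> {k..<k + N}" if "j < k" for j using col[OF that] by (rule var)
    ultimately have "free_vars \<psi> \<subseteq> {..<k} \<union> {k..<k + N}"
      unfolding \<psi>_def free_vars.simps free_vars_conj_list using Q'(2) qs by fastforce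
    then show ?thesis by (auto simp: \<phi>_def free_vars_exists_list)
  qed
  moreover have "?S = {t \<in> tuples (dom_set M) k. sat M ((!) t) \<phi>}"
  proof (intro equalityI subsetI)
    fix t assume "t \<in> ?S"
    then obtain g where g: "g \<in> Pol M" "fst g = m" and t: "t = act g k rs"
      by (auto simp: m_def)
    then have tk: "t \<in> tuples (dom_set M) k"
      using act_in_tuples[OF Pol_operation[OF g(1)]] rsT by (simp add: A_def)
    have gF: "snd g \<in> T \<rightarrow>\<^sub>E A"
      using Pol_operation[OF g(1)] g(2) by (auto simp: operations_def T_def A_def)
    define w where
      "w x = (if x \<in> {k..<k + N} then snd g (inv_into T idx (x - k)) else t ! x)" for x
    have wvar: "w (var xs) = snd g xs" if "xs \<in> T" for xs
      using var[OF that] that idx(2) by (simp add: w_def var_def inv_into_f_f)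
    have "snd (op w) = snd g"
      using gF wvar by (intro PiE_ext[of _ T "\<lambda>_. A"]) (auto simp: op_def)
    moreover have "(m, snd g) \<in> Pol M" using g by (metis prod.collapse)
    ultimately have "sat M w (atom q)" if "q \<in> Q" for q
      using sat_atom[OF that] PolQ[OF gF] that by simp
    moreover have "w j = w (var (col j))" if "j < k" for j
      using that wvar[OF col[OF that]] by (simp add: w_def t col_def)
    ultimately have "sat M w \<psi>"
      using ne Q'(2) qs by (auto simp: \<psi>_def sat_conj_list)
    moreover have "w x \<in> dom_set M" if "x \<in> {k..<k + N}" for x
    proof -
      have "x - k \<in> idx ` T" using that idx(1) by auto
      then have "inv_into T idx (x - k) \<in> T" by (rule inv_into_into)
      then show ?thesis using gF that by (auto simp: w_def A_def)
    qed
    moreover have "\<forall>x. x \<notin> {k..<k + N} \<longrightarrow> w x = t ! x" unfolding w_def by simp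
    ultimately have "sat M ((!) t) \<phi>"
      unfolding \<phi>_def sat_exists_list set_upt by blast
    with tk show "t \<in> {t \<in> tuples (dom_set M) k. sat M ((!) t) \<phi>}" by simp
  next
    fix t assume "t \<in> {t \<in> tuples (dom_set M) k. sat M ((!) t) \<phi>}"
    then have t: "t \<in> tuples (dom_set M) k" and "sat M ((!) t) \<phi>" by auto
    then obtain w where w: "\<And>x. x \<in> {k..<k + N} \<Longrightarrow> w x \<in> dom_set M"
      "\<And>x. x \<notin> {k..<k + N} \<Longrightarrow> w x = t ! x" and \<psi>: "sat M w \<psi>"
      unfolding \<phi>_def sat_exists_list set_upt by blast
    have F: "snd (op w) \<in> T \<rightarrow>\<^sub>E A" using w(1) var by (auto simp: op_def A_def)
    have "\<forall>q\<in>Q'. sat M w (atom q)" using \<psi> qs ne by (auto simp: \<psi>_def sat_conj_list)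
    then have "\<forall>q\<in>Q'. ok q (snd (op w))" using sat_atom Q'(2) by blast
    then have "\<forall>q\<in>Q. ok q (snd (op w))" by (rule Q'(3)[OF F])
    then have "op w \<in> Pol M" using PolQ[OF F] by (simp add: op_def)
    moreover have "t = act (op w) k rs"
    proof (rule nth_equalityI)
      show "length t = length (act (op w) k rs)" using t by (simp add: tuples_def)
      fix j assume "j < length t"
      then have j: "j < k" using t by (simp add: tuples_def)
      have "t ! j = w (var (col j))"
        using \<psi> ne j w(2)[of j] by (auto simp: \<psi>_def sat_conj_list)
      then show "t ! j = act (op w) k rs ! j" using j col[OF j] by (simp add: op_def col_def)
    qed
    ultimately show "t \<in> ?S" by (auto simp: op_def m_def)
  qed
  ultimately show ?thesis unfolding pp_definable_def by blast
qed


section \<open>Minors and reflections of powers\<close>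

lemma compose_projections:
  "xs \<in> tuples A m \<Longrightarrow>
    snd (compose_op A m f (map (projection A m) is)) xs = snd f (map ((!) xs) is)"
  by (simp add: compose_op_def projection_def comp_def)

lemma fst_compose_op [simp]: "fst (compose_op A m f gs) = m"
  by (simp add: compose_op_def)

lemma select_in_tuples:
  "xs \<in> tuples A m \<Longrightarrow> is \<in> tuples {..<m} n \<Longrightarrow> map ((!) xs) is \<in> tuples A n"
  by (fastforce simp: tuples_def subset_iff in_set_conv_nth)

lemma minor_in_Pol:
  assumes M: "is_structure M" and f: "f \<in> Pol M" and m: "1 \<le> m"
    and "is": "is \<in> tuples {..<m} (fst f)"
  shows "compose_op (dom_set M) m f (map (projection (dom_set M) m) is) \<in> Pol M"
proof -
  let ?gs = "map (projection (dom_set M) m) is"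
  have c: "function_clone (dom_set M) (Pol M)" by (rule function_clone_Pol[OF M])
  have "length ?gs = fst f" using "is" by (simp add: tuples_def)
  moreover have "set ?gs \<subseteq> Pol M"
    using c m "is" by (auto simp: function_clone_def tuples_def)
  moreover have "\<forall>g\<in>set ?gs. fst g = m" by (auto simp: projection_def)
  ultimately show ?thesis using c m f unfolding function_clone_def by blast
qed

lemma projection_in_Pol:
  "is_structure M \<Longrightarrow> i < m \<Longrightarrow> projection (dom_set M) m i \<in> Pol M"
  using function_clone_Pol[of M] by (auto simp: function_clone_def)

lemma h1_clone_homomorphism_trans:
  assumes "h1_clone_homomorphism A F B G \<xi>" "h1_clone_homomorphism B G C H \<zeta>"
  shows "h1_clone_homomorphism A F C H (\<lambda>f. \<zeta> (\<xi> f))"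
  using assms unfolding h1_clone_homomorphism_def by simp

text \<open>Reflection of a componentwise action on a power, where \<open>p c\<close> is only evaluated on \<open>J\<close>.\<close>

definition power_reflect ::
  "'j set \<Rightarrow> ('c \<Rightarrow> 'j \<Rightarrow> 'a) \<Rightarrow> (('j \<Rightarrow> 'a) \<Rightarrow> 'c) \<Rightarrow> 'c set \<Rightarrow> 'a operation \<Rightarrow> 'c operation"
  where
  "power_reflect J p q C f =
    (fst f, \<lambda>cs\<in>tuples C (fst f). q (\<lambda>j\<in>J. snd f (map (\<lambda>c. p c j) cs)))"

lemma fst_power_reflect [simp]: "fst (power_reflect J p q C f) = fst f"
  by (simp add: power_reflect_def)

text \<open>Both composition with projections on the source and on the target select the same entries of the
  argument list, and selecting entries commutes with applying \<open>p\<close> to each of them.\<close>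

lemma h1_power_reflect:
  fixes A :: "'b set"
  assumes p: "\<And>c j. c \<in> C \<Longrightarrow> j \<in> J \<Longrightarrow> p c j \<in> A"
    and G: "\<And>f. f \<in> F \<Longrightarrow> power_reflect J p q C f \<in> G"
  shows "h1_clone_homomorphism A F C G (power_reflect J p q C)"
  unfolding h1_clone_homomorphism_def
proof (intro conjI ballI allI impI)
  fix f :: "'b operation" and m :: nat and "is" :: "nat list"
  assume f: "f \<in> F" and m: "1 \<le> m" and "is": "is \<in> tuples {..<m} (fst f)"
  let ?f = "compose_op A m f (map (projection A m) is)"
  have "q (\<lambda>j\<in>J. snd ?f (map (\<lambda>c. p c j) cs)) =
      snd (power_reflect J p q C f) (map ((!) cs) is)" if cs: "cs \<in> tuples C m" for cs
  proof -
    have "snd ?f (map (\<lambda>c. p c j) cs) = snd f (map (\<lambda>c. p c j) (map ((!) cs) is))"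
      if j: "j \<in> J" for j
    proof -
      have "map (\<lambda>c. p c j) cs \<in> tuples A m" using cs p[OF _ j] by (rule map_in_tuples)
      moreover have "map ((!) (map (\<lambda>c. p c j) cs)) is = map (\<lambda>c. p c j) (map ((!) cs) is)"
        using "is" cs by (auto simp: tuples_def)
      ultimately show ?thesis by (simp only: compose_projections)
    qed
    then have "(\<lambda>j\<in>J. snd ?f (map (\<lambda>c. p c j) cs)) =
        (\<lambda>j\<in>J. snd f (map (\<lambda>c. p c j) (map ((!) cs) is)))" by auto
    then show ?thesis using select_in_tuples[OF cs "is"] by (simp add: power_reflect_def)
  qed
  then show "power_reflect J p q C ?f =
      compose_op C m (power_reflect J p q C f) (map (projection C m) is)"
    by (intro prod_eqI ext)
      (auto simp: power_reflect_def compose_op_def projection_def comp_def)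
qed (auto simp: G)

text \<open>This is condition (ii) with the index set normalised to an initial segment of the naturals, and
  with \<open>q\<close> total: its values matter only at the points where the reflected operations are
  evaluated.\<close>

definition finite_power_reflection ::
  "('a, 's) rel_structure \<Rightarrow> ('c, 't) rel_structure \<Rightarrow> bool" where
  "finite_power_reflection A C \<longleftrightarrow>
    (\<exists>n::nat. \<exists>p q. 1 \<le> n \<and> (\<forall>c\<in>dom_set C. \<forall>j<n. p c j \<in> dom_set A) \<and>
      (\<forall>f\<in>Pol A. power_reflect {..<n} p q (dom_set C) f \<in> Pol C))"

lemma finite_power_reflection_h1:
  assumes "finite_power_reflection A C"
  shows "\<exists>\<xi>. h1_clone_homomorphism (dom_set A) (Pol A) (dom_set C) (Pol C) \<xi>"
proof -
  obtain n p q where "\<forall>c\<in>dom_set C. \<forall>j<n. p c j \<in> dom_set A"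
    "\<forall>f\<in>Pol A. power_reflect {..<n::nat} p q (dom_set C) f \<in> Pol C"
    using assms unfolding finite_power_reflection_def by metis
  then have "h1_clone_homomorphism (dom_set A) (Pol A) (dom_set C) (Pol C)
      (power_reflect {..<n} p q (dom_set C))"
    by (intro h1_power_reflect) auto
  then show ?thesis by blast
qed

text \<open>Unary polymorphisms are the endomorphisms. This property is inherited along all constructions
  and replaces the finiteness of the structures in a chain, which is not.\<close>

definition has_finite_image_endo :: "('a, 's) rel_structure \<Rightarrow> bool" where
  "has_finite_image_endo M \<longleftrightarrow>
    (\<exists>u\<in>Pol M. fst u = 1 \<and> finite (snd u ` tuples (dom_set M) 1))"

lemma finite_has_finite_image_endo:
  assumes "is_structure M" "finite (dom_set M)"
  shows "has_finite_image_endo M"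
proof -
  have "projection (dom_set M) 1 0 \<in> Pol M" using assms(1) by (intro projection_in_Pol) simp_all
  moreover have "finite (snd (projection (dom_set M) 1 0) ` tuples (dom_set M) 1)"
    using finite_tuples[OF assms(2)] by simp
  ultimately show ?thesis
    unfolding has_finite_image_endo_def by (intro bexI) (auto simp: projection_def)
qed

text \<open>The reflection of an endomorphism with image \<open>S\<close> takes its values in the \<open>q\<close>-image of the finite
  set $S^n$.\<close>

lemma finite_power_reflection_finite_image_endo:
  assumes "finite_power_reflection A C" "has_finite_image_endo A"
  shows "has_finite_image_endo C"
proof -
  obtain n :: nat and p q where p: "\<forall>c\<in>dom_set C. \<forall>j<n. p c j \<in> dom_set A"
    and q: "\<forall>f\<in>Pol A. power_reflect {..<n} p q (dom_set C) f \<in> Pol C"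
    using assms(1) unfolding finite_power_reflection_def by metis
  obtain u where u: "u \<in> Pol A" "fst u = 1" "finite (snd u ` tuples (dom_set A) 1)"
    using assms(2) unfolding has_finite_image_endo_def by blast
  let ?v = "power_reflect {..<n} p q (dom_set C) u"
  have "snd ?v ` tuples (dom_set C) 1 \<subseteq> q ` ({..<n} \<rightarrow>\<^sub>E snd u ` tuples (dom_set A) 1)"
  proof
    fix y assume "y \<in> snd ?v ` tuples (dom_set C) 1"
    then obtain cs where cs: "cs \<in> tuples (dom_set C) 1"
      and y: "y = q (\<lambda>j\<in>{..<n}. snd u (map (\<lambda>c. p c j) cs))"
      using u(2) by (auto simp: power_reflect_def)
    have "map (\<lambda>c. p c j) cs \<in> tuples (dom_set A) 1" if "j < n" for j
      using cs by (rule map_in_tuples) (use p that in auto)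
    then show "y \<in> q ` ({..<n} \<rightarrow>\<^sub>E snd u ` tuples (dom_set A) 1)" unfolding y by auto
  qed
  then have "finite (snd ?v ` tuples (dom_set C) 1)"
    by (rule finite_subset) (use u in \<open>auto intro!: finite_PiE\<close>)
  then show ?thesis
    using q u unfolding has_finite_image_endo_def
    by (intro bexI[of _ ?v]) (auto simp: power_reflect_def)
qed


section \<open>Homomorphic equivalences and pp-interpretations as reflections\<close>

lemma hom_equivalent_sym: "hom_equivalent M N \<Longrightarrow> hom_equivalent N M"
  by (auto simp: hom_equivalent_def same_signature_def)

lemma hom_equivalent_finite_power_reflection:
  assumes A: "is_structure A" and C: "is_structure C" and "hom_equivalent A C"
  shows "finite_power_reflection A C"
proof -
  obtain h k where sig: "same_signature A C"
    and h: "homomorphism C A h" and k: "homomorphism A C k"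
    using assms(3) by (auto simp: hom_equivalent_def)
  let ?q = "\<lambda>x. k (x 0)"
  have "power_reflect {..<1::nat} (\<lambda>c j. h c) ?q (dom_set C) f \<in> Pol C" if f: "f \<in> Pol A" for f
  proof -
    have "(fst f, \<lambda>cs\<in>tuples (dom_set C) (fst f). k (snd f (map h cs))) \<in> Pol C"
    proof (rule restrict_in_Pol[OF C Pol_arity_pos[OF f]])
      fix cs assume "cs \<in> tuples (dom_set C) (fst f)"
      then have "map h cs \<in> tuples (dom_set A) (fst f)"
        by (rule map_in_tuples) (use h in \<open>auto simp: homomorphism_def\<close>)
      then have "snd f (map h cs) \<in> dom_set A" using operation_closed Pol_operation f by metis
      then show "k (snd f (map h cs)) \<in> dom_set C" using k by (auto simp: homomorphism_def)
    next
      fix R ts assume R: "R \<in> symbols C" and ts: "ts \<in> tuples (interp C R) (fst f)"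
        "ts \<in> tuples (tuples (dom_set C) (arity C R)) (fst f)"
      have R': "R \<in> symbols A" "arity A R = arity C R"
        using R sig by (auto simp: same_signature_def)
      have "map (map h) ts \<in> tuples (interp A R) (fst f)"
        using ts(1) by (rule map_in_tuples) (use h R in \<open>auto simp: homomorphism_def\<close>)
      then have "act f (arity C R) (map (map h) ts) \<in> interp A R"
        using Pol_act[OF f R'(1)] R' by simp
      then have "map k (act f (arity C R) (map (map h) ts)) \<in> interp C R"
        using k R' by (auto simp: homomorphism_def)
      also have "map k (act f (arity C R) (map (map h) ts)) =
          map (\<lambda>j. k (snd f (map h (map (\<lambda>t. t ! j) ts)))) [0..<arity C R]"
        by (simp add: act_map[OF ts(2)] comp_def)
      finally show "map (\<lambda>j. k (snd f (map h (map (\<lambda>t. t ! j) ts)))) [0..<arity C R]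
          \<in> interp C R" .
    qed
    then show ?thesis by (simp add: power_reflect_def)
  qed
  moreover have "\<forall>c\<in>dom_set C. \<forall>j<(1::nat). h c \<in> dom_set A"
    using h by (auto simp: homomorphism_def)
  ultimately show ?thesis unfolding finite_power_reflection_def
    by (intro exI[of _ "1::nat"] exI[of _ "\<lambda>c j. h c"] exI[of _ ?q]) auto
qed

text \<open>With a section \<open>s\<close> of the interpreting map \<open>f\<close>, an operation \<open>g\<close> becomes
  $f(g(s(c_1),\dots,s(c_m)))$. The point $g(s(c_1),\dots,s(c_m))$ is again in the domain of \<open>f\<close>, and
  tuples of such points remain in the preimages of the relations, because \<open>g\<close> preserves
  pp-definable relations.\<close>

lemma pp_interprets_finite_power_reflection:
  assumes A: "is_structure A" and C: "is_structure C" and "pp_interprets A C"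
  shows "finite_power_reflection A C"
proof -
  obtain n X f where n: "1 \<le> n" and X: "X \<subseteq> tuples (dom_set A) n" "f ` X = dom_set C"
    and ppX: "pp_definable A n X"
    and ppR: "\<And>R. R \<in> symbols C \<Longrightarrow>
      pp_definable A (arity C R * n) (flat_preimage f X (arity C R) (interp C R))"
    using assms(3) unfolding pp_interprets_def by blast
  define s where "s = inv_into X f"
  have s: "s c \<in> X" "f (s c) = c" if "c \<in> dom_set C" for c
    using that X(2) by (auto simp: s_def inv_into_into f_inv_into_f)
  have lenX: "length x = n" if "x \<in> X" for x using X(1) that by (auto simp: tuples_def)
  let ?p = "\<lambda>c j. s c ! j" and ?q = "\<lambda>x. f (map x [0..<n])"
  have "power_reflect {..<n} ?p ?q (dom_set C) g \<in> Pol C" if g: "g \<in> Pol A" for g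
  proof -
    have closed: "act g n (map s cs) \<in> X" if "cs \<in> tuples (dom_set C) (fst g)" for cs
      using map_in_tuples[OF that, of s X] s Pol_preserves_pp_definable[OF g ppX]
      unfolding preserves_iff_act by blast
    have "(fst g, \<lambda>cs\<in>tuples (dom_set C) (fst g). f (act g n (map s cs))) \<in> Pol C"
    proof (rule restrict_in_Pol[OF C Pol_arity_pos[OF g]])
      show "f (act g n (map s cs)) \<in> dom_set C" if "cs \<in> tuples (dom_set C) (fst g)" for cs
        using closed[OF that] X(2) by blast
    next
      fix R ts assume R: "R \<in> symbols C" and ts: "ts \<in> tuples (interp C R) (fst g)"
        "ts \<in> tuples (tuples (dom_set C) (arity C R)) (fst g)"
      let ?k = "arity C R"
      let ?us = "map (\<lambda>j. act g n (map s (map (\<lambda>t. t ! j) ts))) [0..<?k]"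
      have tss: "map s t \<in> tuples X ?k" "map f (map s t) = t" if "t \<in> set ts" for t
      proof -
        have t: "t \<in> tuples (dom_set C) ?k" using that ts(2) by (auto simp: tuples_def)
        then show "map s t \<in> tuples X ?k" by (rule map_in_tuples) (rule s)
        show "map f (map s t) = t" using t s(2) by (auto simp: tuples_def intro!: map_idI)
      qed
      have "map concat (map (map s) ts) \<in> tuples (flat_preimage f X ?k (interp C R)) (fst g)"
        using tss ts(1) by (auto simp: tuples_def flat_preimage_def)
      then have "act g (?k * n) (map concat (map (map s) ts)) \<in> flat_preimage f X ?k (interp C R)"
        using Pol_preserves_pp_definable[OF g ppR[OF R]] unfolding preserves_iff_act by blast
      also have "act g (?k * n) (map concat (map (map s) ts)) =
          concat (map (\<lambda>j. act g n (map (\<lambda>ts. ts ! j) (map (map s) ts))) [0..<?k])"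
        by (rule act_concat) (use tss(1) lenX in \<open>fastforce simp: tuples_def\<close>)
      also have "map (\<lambda>j. act g n (map (\<lambda>ts. ts ! j) (map (map s) ts))) [0..<?k] = ?us"
        by (intro map_cong refl) (subst map_column[OF ts(2)], auto)
      finally obtain vs where vs: "concat vs = concat ?us" "vs \<in> tuples X ?k"
        "map f vs \<in> interp C R" by (auto simp: flat_preimage_def)
      \<comment> \<open>\<open>flat_preimage\<close> gives some preimage tuple; equal block lengths identify it as the expected one.\<close>
      have "vs = ?us"
        using vs(1) by (rule concat_uniform_inject) (use vs(2) lenX in \<open>auto simp: tuples_def\<close>)
      with vs(3) show "map (\<lambda>j. f (act g n (map s (map (\<lambda>t. t ! j) ts)))) [0..<?k] \<in> interp C R"
        by (simp add: comp_def)
    qed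
    also have "(fst g, \<lambda>cs\<in>tuples (dom_set C) (fst g). f (act g n (map s cs))) =
        power_reflect {..<n} ?p ?q (dom_set C) g"
    proof -
      have "act g n (map s cs) = map (\<lambda>j\<in>{..<n}. snd g (map (\<lambda>c. s c ! j) cs)) [0..<n]" for cs
        by (simp add: act_def comp_def)
      then show ?thesis by (simp add: power_reflect_def)
    qed
    finally show ?thesis .
  qed
  moreover have "\<forall>c\<in>dom_set C. \<forall>j<n. s c ! j \<in> dom_set A"
    using s(1) X(1) by (fastforce simp: tuples_def)
  ultimately show ?thesis unfolding finite_power_reflection_def
    by (intro exI[of _ n] exI[of _ ?p] exI[of _ ?q]) (use n in auto)
qed

text \<open>The inverse of the isomorphism onto the structure on $A^n$ is the interpreting map. As it is
  injective, the preimage of equality is just equality of two $n$-tuples.\<close>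

lemma pp_power_pp_interprets:
  assumes A: "is_structure A" and "pp_power A C"
  shows "pp_interprets A C"
proof -
  obtain n D where n: "1 \<le> n" and D: "is_structure D" "dom_set D = tuples (dom_set A) n"
    and pp: "\<And>R. R \<in> symbols D \<Longrightarrow> pp_definable A (arity D R * n) (concat ` interp D R)"
    and iso: "isomorphic C D"
    using assms(2) unfolding pp_power_def by blast
  obtain g where sig: "same_signature C D" and g: "bij_betw g (dom_set C) (dom_set D)"
    and rel: "\<And>R t. R \<in> symbols C \<Longrightarrow> t \<in> tuples (dom_set C) (arity C R) \<Longrightarrow>
      t \<in> interp C R \<longleftrightarrow> map g t \<in> interp D R"
    using iso unfolding isomorphic_def isomorphism_def by blast
  have C: "is_structure C" using assms(2) by (simp add: pp_power_def)
  have ne: "dom_set A \<noteq> {}" using A by (simp add: is_structure_def)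
  define X where "X = tuples (dom_set A) n"
  define f where "f = inv_into (dom_set C) g"
  have f: "bij_betw f X (dom_set C)"
    using bij_betw_inv_into[OF g] by (simp add: f_def X_def D)
  have gf: "g (f x) = x" if "x \<in> X" for x
    using that g D by (simp add: f_def X_def bij_betw_inv_into_right)
  have "pp_definable A n X"
    unfolding pp_definable_def
    by (intro disjI2 exI[of _ "conj_list []"])
      (auto simp: pp_formula_conj_list formula_over_conj_list free_vars_conj_list
        sat_conj_list[OF ne] X_def)
  moreover have "pp_definable A (2 * n) (flat_preimage f X 2 {[c, c] |c. c \<in> dom_set C})"
  proof -
    let ?\<phi> = "conj_list (map (\<lambda>i. Equal i (n + i)) [0..<n])"
    have "flat_preimage f X 2 {[c, c] |c. c \<in> dom_set C} = {x @ x |x. x \<in> X}"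
    proof (intro equalityI subsetI)
      fix t assume "t \<in> flat_preimage f X 2 {[c, c] |c. c \<in> dom_set C}"
      then obtain ts c where ts: "ts \<in> tuples X 2" "map f ts = [c, c]" and t: "t = concat ts"
        by (auto simp: flat_preimage_def)
      then obtain x y where xy: "ts = [x, y]" "f x = c" "f y = c"
        by (auto simp: map_eq_Cons_conv)
      then have "x = y" using ts f by (auto simp: tuples_def bij_betw_def inj_on_def)
      then show "t \<in> {x @ x |x. x \<in> X}" using xy t ts by (auto simp: tuples_def)
    next
      fix t assume "t \<in> {x @ x |x. x \<in> X}"
      then obtain x where x: "x \<in> X" "t = concat [x, x]" by auto
      moreover have "f x \<in> dom_set C" using f x by (auto simp: bij_betw_def)
      ultimately show "t \<in> flat_preimage f X 2 {[c, c] |c. c \<in> dom_set C}"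
        unfolding flat_preimage_def by (intro image_eqI[of _ _ "[x, x]"]) (auto simp: tuples_def)
    qed
    also have "\<dots> = {t \<in> tuples (dom_set A) (2 * n). sat A ((!) t) ?\<phi>}"
    proof (intro equalityI subsetI)
      fix t assume "t \<in> {x @ x |x. x \<in> X}"
      then show "t \<in> {t \<in> tuples (dom_set A) (2 * n). sat A ((!) t) ?\<phi>}"
        by (auto simp: X_def tuples_def sat_conj_list[OF ne] nth_append)
    next
      fix t assume "t \<in> {t \<in> tuples (dom_set A) (2 * n). sat A ((!) t) ?\<phi>}"
      then have t: "length t = 2 * n" "set t \<subseteq> dom_set A" "\<forall>i<n. t ! i = t ! (n + i)"
        by (auto simp: tuples_def sat_conj_list[OF ne])
      have "drop n t = take n t" using t by (intro nth_equalityI) auto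
      then have "t = take n t @ take n t" by (metis append_take_drop_id)
      moreover have "take n t \<in> X" using t set_take_subset[of n t] by (auto simp: X_def tuples_def)
      ultimately show "t \<in> {x @ x |x. x \<in> X}" by blast
    qed
    finally show ?thesis unfolding pp_definable_def
      by (intro disjI2 exI[of _ ?\<phi>])
        (auto simp: pp_formula_conj_list formula_over_conj_list free_vars_conj_list)
  qed
  moreover have "pp_definable A (arity C R * n) (flat_preimage f X (arity C R) (interp C R))"
    if R: "R \<in> symbols C" for R
  proof -
    have R': "R \<in> symbols D" "arity D R = arity C R" using R sig by (auto simp: same_signature_def)
    have "ts \<in> interp D R \<longleftrightarrow> map f ts \<in> interp C R" if ts: "ts \<in> tuples X (arity C R)" for ts
    proof -
      have "map f ts \<in> tuples (dom_set C) (arity C R)"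
        using ts by (rule map_in_tuples) (use f in \<open>auto simp: bij_betw_def\<close>)
      moreover have "map g (map f ts) = ts"
        using ts gf by (auto simp: tuples_def intro!: map_idI)
      ultimately show ?thesis using rel[OF R] by metis
    qed
    moreover have "interp D R \<subseteq> tuples X (arity C R)"
      using interp_subset_tuples[OF D(1) R'(1)] R' D by (simp add: X_def)
    ultimately have "{ts \<in> tuples X (arity C R). map f ts \<in> interp C R} = interp D R" by blast
    then show ?thesis using pp[OF R'(1)] R' by (simp add: flat_preimage_def)
  qed
  ultimately show ?thesis
    unfolding pp_interprets_def using n f
    by (intro exI[of _ n] conjI exI[of _ X] exI[of _ f]) (auto simp: X_def bij_betw_def)
qed


section \<open>Adding constants to cores\<close>

text \<open>Restricting the diagonal to the domain makes the diagonals of an operation and of its minors equal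
  as functions.\<close>

definition diagonal :: "('a, 's) rel_structure \<Rightarrow> 'a operation \<Rightarrow> 'a \<Rightarrow> 'a" where
  "diagonal M f = (\<lambda>x\<in>dom_set M. snd f (replicate (fst f) x))"

lemma homomorphism_diagonal:
  assumes M: "is_structure M" and f: "f \<in> Pol M"
  shows "homomorphism M M (diagonal M f)"
  unfolding homomorphism_def
proof (intro conjI ballI)
  have "replicate (fst f) x \<in> tuples (dom_set M) (fst f)" if "x \<in> dom_set M" for x
    using that by (auto simp: tuples_def)
  then show "diagonal M f \<in> dom_set M \<rightarrow> dom_set M"
    using operation_closed[OF Pol_operation[OF f]] by (auto simp: diagonal_def)
  fix R t assume R: "R \<in> symbols M" and t: "t \<in> interp M R"
  have "replicate (fst f) t \<in> tuples (interp M R) (fst f)" using t by (auto simp: tuples_def)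
  then have "act f (arity M R) (replicate (fst f) t) \<in> interp M R" by (rule Pol_act[OF f R])
  also have "act f (arity M R) (replicate (fst f) t) = map (diagonal M f) t"
    using interp_subset_tuples[OF M R] t
    by (intro nth_equalityI) (auto simp: tuples_def diagonal_def subset_iff)
  finally show "map (diagonal M f) t \<in> interp M R" .
qed

lemma diagonal_minor:
  assumes f: "f \<in> Pol M" and "is": "is \<in> tuples {..<m} (fst f)"
  shows "diagonal M (compose_op (dom_set M) m f (map (projection (dom_set M) m) is)) = diagonal M f"
proof -
  have "map ((!) (replicate m x)) is = replicate (fst f) x" for x :: 'a
    using "is" by (intro nth_equalityI) (auto simp: tuples_def subset_iff)
  moreover have "replicate m x \<in> tuples (dom_set M) m" if "x \<in> dom_set M" for x
    using that by (auto simp: tuples_def)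
  ultimately show ?thesis
    unfolding diagonal_def by (intro restrict_ext) (simp only: compose_projections fst_compose_op)
qed

lemma model_complete_coreD:
  "model_complete_core M \<Longrightarrow> homomorphism M M e \<Longrightarrow> finite F \<Longrightarrow> F \<subseteq> dom_set M \<Longrightarrow>
    \<exists>\<alpha>. isomorphism M M \<alpha> \<and> (\<forall>x\<in>F. \<alpha> x = e x)"
  by (simp add: model_complete_core_def)

text \<open>An endomorphism of a model-complete core agrees on any two points with an automorphism, so it is
  injective; if its image is finite, so is the domain.\<close>

lemma finite_model_complete_core:
  assumes M: "is_structure M" "model_complete_core M" "has_finite_image_endo M"
  shows "finite (dom_set M)"
proof -
  obtain u where u: "u \<in> Pol M" "fst u = 1" "finite (snd u ` tuples (dom_set M) 1)"
    using M(3) unfolding has_finite_image_endo_def by blast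
  let ?e = "diagonal M u"
  have e: "homomorphism M M ?e" using M(1) u(1) by (rule homomorphism_diagonal)
  have "inj_on ?e (dom_set M)"
  proof (rule inj_onI)
    fix x y assume xy: "x \<in> dom_set M" "y \<in> dom_set M" "?e x = ?e y"
    obtain \<alpha> where \<alpha>: "isomorphism M M \<alpha>" "\<forall>z\<in>{x, y}. \<alpha> z = ?e z"
      using model_complete_coreD[OF M(2) e, of "{x, y}"] xy by auto
    then have "inj_on \<alpha> (dom_set M)" by (simp add: isomorphism_def bij_betw_def)
    then show "x = y" using xy \<alpha>(2) by (simp add: inj_on_def)
  qed
  moreover have "?e ` dom_set M \<subseteq> snd u ` tuples (dom_set M) 1"
    using u(2) by (auto simp: diagonal_def tuples_def)
  then have "finite (?e ` dom_set M)" using u(3) finite_subset by blast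
  ultimately show ?thesis by (rule finite_imageD[rotated])
qed

lemma finite_core_endo_isomorphism:
  assumes "model_complete_core M" "finite (dom_set M)" "homomorphism M M e"
  shows "bij_betw e (dom_set M) (dom_set M)"
    and "\<And>R t. R \<in> symbols M \<Longrightarrow> t \<in> tuples (dom_set M) (arity M R) \<Longrightarrow>
      map e t \<in> interp M R \<Longrightarrow> t \<in> interp M R"
proof -
  obtain \<alpha> where \<alpha>: "isomorphism M M \<alpha>" "\<forall>z\<in>dom_set M. \<alpha> z = e z"
    using model_complete_coreD[OF assms(1,3,2)] by auto
  then have "bij_betw \<alpha> (dom_set M) (dom_set M)" by (simp add: isomorphism_def)
  then show "bij_betw e (dom_set M) (dom_set M)" using \<alpha>(2) bij_betw_cong[of "dom_set M" \<alpha> e] by simp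
  fix R t assume R: "R \<in> symbols M" and t: "t \<in> tuples (dom_set M) (arity M R)"
    and "map e t \<in> interp M R"
  moreover have "map e t = map \<alpha> t" using t \<alpha>(2) by (auto simp: tuples_def)
  ultimately show "t \<in> interp M R" using \<alpha>(1) by (simp add: isomorphism_def)
qed

text \<open>The h1 clone homomorphism sends \<open>f\<close> to the composition of \<open>f\<close> with the inverse of its diagonal,
  which is an automorphism. The result is idempotent, so it preserves the new singleton. It need not
  respect composition in general, but minors share the diagonal of \<open>f\<close>, and this suffices.\<close>

lemma singleton_expansion_h1:
  assumes M: "is_structure M" "model_complete_core M" "finite (dom_set M)"
    and N: "is_structure N" "singleton_expansion M N"
  shows "\<exists>\<xi>. h1_clone_homomorphism (dom_set M) (Pol M) (dom_set N) (Pol N) \<xi>"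
proof -
  obtain c a where dom: "dom_set N = dom_set M" and a: "a \<in> dom_set M"
    and syms: "symbols N = insert c (symbols M)"
    and old': "\<forall>R\<in>symbols M. arity N R = arity M R \<and> interp N R = interp M R"
    and c: "arity N c = 1" "interp N c = {[a]}"
    using N(2) unfolding singleton_expansion_def by metis
  note old = bspec[OF old']
  define undiag where "undiag f = inv_into (dom_set M) (diagonal M f)" for f
  define \<xi> where "\<xi> f = (fst f, \<lambda>xs\<in>tuples (dom_set M) (fst f). undiag f (snd f xs))" for f
  have bij: "bij_betw (diagonal M f) (dom_set M) (dom_set M)" if "f \<in> Pol M" for f
    using finite_core_endo_isomorphism(1)[OF M(2,3) homomorphism_diagonal[OF M(1) that]] .
  have undiag: "undiag f y \<in> dom_set M" "diagonal M f (undiag f y) = y"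
    if "f \<in> Pol M" "y \<in> dom_set M" for f y
    using bij[OF that(1)] that(2) by (auto simp: undiag_def bij_betw_def inv_into_into f_inv_into_f)
  have Pol: "\<xi> f \<in> Pol N" if f: "f \<in> Pol M" for f
  proof -
    have op: "snd f xs \<in> dom_set M" if "xs \<in> tuples (dom_set M) (fst f)" for xs
      using that operation_closed[OF Pol_operation[OF f]] by blast
    have "(fst f, \<lambda>xs\<in>tuples (dom_set N) (fst f). undiag f (snd f xs)) \<in> Pol N"
    proof (rule restrict_in_Pol[OF N(1) Pol_arity_pos[OF f]])
      show "undiag f (snd f xs) \<in> dom_set N" if "xs \<in> tuples (dom_set N) (fst f)" for xs
        using that op undiag[OF f] dom by simp
    next
      fix R ts assume R: "R \<in> symbols N" and ts: "ts \<in> tuples (interp N R) (fst f)"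
        "ts \<in> tuples (tuples (dom_set N) (arity N R)) (fst f)"
      let ?s = "map (\<lambda>j. undiag f (snd f (map (\<lambda>t. t ! j) ts))) [0..<arity N R]"
      have col: "snd f (map (\<lambda>t. t ! j) ts) \<in> dom_set M" if "j < arity N R" for j
        using column_in_tuples[OF ts(2) that] op dom by simp
      show "?s \<in> interp N R"
      proof (cases "R \<in> symbols M")
        case True
        have "map (diagonal M f) ?s = act f (arity M R) ts"
          using col undiag(2)[OF f] old[OF True] by (auto simp: act_def)
        also have "\<dots> \<in> interp M R" using Pol_act[OF f True] ts(1) old[OF True] by simp
        finally have "map (diagonal M f) ?s \<in> interp M R" .
        moreover have "?s \<in> tuples (dom_set M) (arity M R)"
          using col undiag(1)[OF f] old[OF True] by (auto simp: tuples_def)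
        ultimately show ?thesis
          using finite_core_endo_isomorphism(2)[OF M(2,3) homomorphism_diagonal[OF M(1) f] True]
            old[OF True] by simp
      next
        case False
        then have Rc: "R = c" using R syms by simp
        have "ts = replicate (fst f) [a]"
          using ts(1) c Rc by (intro replicate_eqI) (auto simp: tuples_def)
        then have "snd f (map (\<lambda>t. t ! 0) ts) = diagonal M f a"
          using a by (simp add: diagonal_def)
        moreover have "undiag f (diagonal M f a) = a"
          using bij[OF f] a by (simp add: undiag_def bij_betw_def inv_into_f_f)
        ultimately show ?thesis using c Rc by simp
      qed
    qed
    then show ?thesis by (simp add: \<xi>_def dom)
  qed
  have "h1_clone_homomorphism (dom_set M) (Pol M) (dom_set N) (Pol N) \<xi>"
    unfolding h1_clone_homomorphism_def
  proof (intro conjI ballI allI impI)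
    fix f :: "'a operation" and m :: nat and "is" :: "nat list"
    assume f: "f \<in> Pol M" and m: "1 \<le> m" and "is": "is \<in> tuples {..<m} (fst f)"
    let ?f = "compose_op (dom_set M) m f (map (projection (dom_set M) m) is)"
    let ?g = "compose_op (dom_set N) m (\<xi> f) (map (projection (dom_set N) m) is)"
    have "undiag ?f = undiag f" using diagonal_minor[OF f "is"] by (simp add: undiag_def)
    then have "undiag ?f (snd ?f xs) = snd ?g xs" if "xs \<in> tuples (dom_set M) m" for xs
      using that select_in_tuples[OF that "is"] by (simp add: compose_projections dom \<xi>_def)
    moreover have "snd ?g xs = undefined" if "xs \<notin> tuples (dom_set M) m" for xs
      using that by (simp add: compose_op_def dom)
    ultimately show "\<xi> ?f = ?g"
      by (intro prod_eqI ext) (auto simp: \<xi>_def restrict_def)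
  qed (auto simp: Pol, simp add: \<xi>_def)
  then show ?thesis by blast
qed


section \<open>Isomorphic copies and pp-constructions\<close>

lemma isomorphic_refl: "isomorphic M M"
  unfolding isomorphic_def isomorphism_def same_signature_def by (intro exI[of _ id]) simp

lemma isomorphic_sym:
  assumes "isomorphic M N"
  shows "isomorphic N M"
proof -
  obtain h where sig: "same_signature M N" and h: "bij_betw h (dom_set M) (dom_set N)"
    and rel: "\<And>R t. R \<in> symbols M \<Longrightarrow> t \<in> tuples (dom_set M) (arity M R) \<Longrightarrow>
      t \<in> interp M R \<longleftrightarrow> map h t \<in> interp N R"
    using assms unfolding isomorphic_def isomorphism_def by blast
  let ?g = "inv_into (dom_set M) h"
  have g: "bij_betw ?g (dom_set N) (dom_set M)" using h by (rule bij_betw_inv_into)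
  have "t \<in> interp N R \<longleftrightarrow> map ?g t \<in> interp M R"
    if R: "R \<in> symbols N" and t: "t \<in> tuples (dom_set N) (arity N R)" for R t
  proof -
    have "map ?g t \<in> tuples (dom_set M) (arity N R)"
      using t by (rule map_in_tuples) (use g in \<open>auto simp: bij_betw_def\<close>)
    moreover have "map h (map ?g t) = t"
      using t bij_betw_inv_into_right[OF h] by (auto simp: tuples_def intro!: map_idI)
    ultimately show ?thesis using rel[of R "map ?g t"] R sig by (simp add: same_signature_def)
  qed
  with sig g show ?thesis unfolding isomorphic_def isomorphism_def
    by (intro exI[of _ ?g]) (auto simp: same_signature_def)
qed

lemma isomorphic_homomorphism:
  assumes "is_structure M" "isomorphic M N"
  shows "\<exists>h. homomorphism M N h"
proof -
  obtain h where "isomorphism M N h" using assms(2) by (auto simp: isomorphic_def)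
  then have "homomorphism M N h"
    using interp_subset_tuples[OF assms(1)]
    by (fastforce simp: homomorphism_def isomorphism_def bij_betw_def)
  then show ?thesis by blast
qed

lemma isomorphic_hom_equivalent:
  assumes "is_structure M" "is_structure N" "isomorphic M N"
  shows "hom_equivalent M N"
  using isomorphic_homomorphism[OF assms(1,3)]
    isomorphic_homomorphism[OF assms(2) isomorphic_sym[OF assms(3)]] assms(3)
  by (auto simp: hom_equivalent_def isomorphic_def isomorphism_def)

lemma hom_equivalent_trans:
  assumes "hom_equivalent L M" "hom_equivalent M N"
  shows "hom_equivalent L N"
proof -
  have comp: "\<exists>h. homomorphism P R h"
    if "same_signature P Q" "homomorphism P Q g" "homomorphism Q R k" for P :: "('x, 's) rel_structure"
      and Q :: "('y, 's) rel_structure" and R :: "('z, 's) rel_structure" and g k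
    using that by (intro exI[of _ "k \<circ> g"])
      (fastforce simp: homomorphism_def same_signature_def simp flip: map_map)
  show ?thesis
    using assms comp[of L M] comp[of N M] unfolding hom_equivalent_def
    by (auto simp: same_signature_def)
qed

lemma finite_structure_copy:
  fixes M :: "('a, 's) rel_structure"
  assumes M: "is_structure M" "finite (dom_set M)"
  obtains N :: "('u::infinite, 's) rel_structure"
  where "is_structure N" "finite (dom_set N)" "isomorphic N M"
proof -
  obtain U :: "'u set" where U: "finite U" "card U = card (dom_set M)"
    using infinite_arbitrarily_large[OF infinite_UNIV] by blast
  then obtain h where h: "bij_betw h U (dom_set M)"
    using finite_same_card_bij[OF U(1) M(2)] by blast
  let ?N = "\<lparr>dom_set = U, symbols = symbols M, arity = arity M,
    interp = \<lambda>R. {t \<in> tuples U (arity M R). map h t \<in> interp M R}\<rparr>"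
  have "U \<noteq> {}" using h M(1) by (auto simp: is_structure_def bij_betw_def)
  then have "is_structure ?N" by (auto simp: is_structure_def)
  moreover have "isomorphic ?N M"
    using h unfolding isomorphic_def isomorphism_def same_signature_def
    by (intro exI[of _ h]) simp
  ultimately show thesis using U(1) that[of ?N] by simp
qed

lemma hom_equivalent_h1:
  assumes "is_structure M" "is_structure N" "hom_equivalent M N"
  shows "\<exists>\<xi>. h1_clone_homomorphism (dom_set M) (Pol M) (dom_set N) (Pol N) \<xi>"
  by (intro finite_power_reflection_h1 hom_equivalent_finite_power_reflection assms)

text \<open>The endomorphism with finite image is carried through the induction because a singleton expansion
  is allowed at cores that are a priori infinite, whereas the h1 clone homomorphism for it is
  available at finite ones.\<close>

lemma pp_construction_chain_h1:
  assumes "pp_construction_step\<^sup>*\<^sup>* A C" "is_structure A" "finite (dom_set A)"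
  shows "is_structure C \<and> has_finite_image_endo C \<and>
    (\<exists>\<xi>. h1_clone_homomorphism (dom_set A) (Pol A) (dom_set C) (Pol C) \<xi>)"
  using assms(1)
proof (induction rule: rtranclp_induct)
  case base
  have "hom_equivalent A A"
    using isomorphic_hom_equivalent[OF assms(2) assms(2)] isomorphic_refl by blast
  then show ?case
    using assms hom_equivalent_h1[OF assms(2) assms(2)] finite_has_finite_image_endo by blast
next
  case (step C D)
  then have C: "is_structure C" and D: "is_structure D" and endo: "has_finite_image_endo C"
    by (auto simp: pp_construction_step_def)
  have "has_finite_image_endo D \<and>
    (\<exists>\<xi>. h1_clone_homomorphism (dom_set C) (Pol C) (dom_set D) (Pol D) \<xi>)"
  proof -
    consider "finite_power_reflection C D"
      | "model_complete_core C" "singleton_expansion C D"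
      using step.hyps(2) C D hom_equivalent_finite_power_reflection[OF C D]
        pp_interprets_finite_power_reflection[OF C D]
      unfolding pp_construction_step_def by blast
    then show ?thesis
    proof cases
      case 1
      then show ?thesis
        using finite_power_reflection_h1 finite_power_reflection_finite_image_endo endo by blast
    next
      case 2
      have fin: "finite (dom_set C)" by (rule finite_model_complete_core[OF C 2(1) endo])
      then have "finite (dom_set D)" using 2(2) by (simp add: singleton_expansion_def)
      then have "has_finite_image_endo D" by (rule finite_has_finite_image_endo[OF D])
      then show ?thesis using singleton_expansion_h1[OF C 2(1) fin D 2(2)] by blast
    qed
  qed
  with step.IH D show ?case using h1_clone_homomorphism_trans by blast
qed


section \<open>From finite power reflections to pp-powers\<close>

text \<open>On $A^n$ take for each relation $R$ of \<open>B\<close> the closure of $p(R)$ under the polymorphisms of \<open>A\<close>.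
  An element of the closure has the form $g(p(t_1),\dots,p(t_m))$, where $t_1,\dots,t_m$ enumerate $R$,
  and \<open>q\<close> maps it to the value of the reflected operation at $t_1,\dots,t_m$, which is in $R$.\<close>

lemma finite_power_reflection_pp_power:
  fixes A :: "('a, 's) rel_structure" and B :: "('b, 't) rel_structure"
  assumes A: "is_structure A" "finite (dom_set A)" and B: "is_structure B" "finite (dom_set B)"
    and AB: "finite_power_reflection A B"
  obtains D :: "('a list, 't) rel_structure" and n
  where "1 \<le> n" "is_structure D" "dom_set D = tuples (dom_set A) n"
    "\<And>R. R \<in> symbols D \<Longrightarrow> pp_definable A (arity D R * n) (concat ` interp D R)"
    "hom_equivalent B D"
proof -
  obtain n :: nat and p q where n: "1 \<le> n"
    and p: "\<forall>c\<in>dom_set B. \<forall>j<n. p c j \<in> dom_set A"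
    and q: "\<forall>f\<in>Pol A. power_reflect {..<n} p q (dom_set B) f \<in> Pol B"
    using AB unfolding finite_power_reflection_def by metis
  let ?X = "tuples (dom_set A) n"
  define P where "P c = map (p c) [0..<n]" for c
  have P: "P c \<in> ?X" if "c \<in> dom_set B" for c using p that by (auto simp: P_def tuples_def)
  obtain b0 where b0: "b0 \<in> dom_set B" using B(1) by (auto simp: is_structure_def)
  \<comment> \<open>\<open>q\<close> is corrected outside the relevant points so that it maps into the domain of \<open>B\<close>.\<close>
  define Q where "Q t = (let b = q (\<lambda>j\<in>{..<n}. t ! j) in if b \<in> dom_set B then b else b0)" for t
  have Q: "Q t \<in> dom_set B" for t using b0 by (simp add: Q_def Let_def)
  have QP: "Q (act g n (map P cs)) = snd (power_reflect {..<n} p q (dom_set B) g) cs"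
    if g: "g \<in> Pol A" and cs: "cs \<in> tuples (dom_set B) (fst g)" for g cs
  proof -
    have "(\<lambda>j\<in>{..<n}. act g n (map P cs) ! j) = (\<lambda>j\<in>{..<n}. snd g (map (\<lambda>c. p c j) cs))"
      by (intro restrict_ext) (simp add: P_def comp_def)
    then have e: "q (\<lambda>j\<in>{..<n}. act g n (map P cs) ! j) =
        snd (power_reflect {..<n} p q (dom_set B) g) cs"
      using cs by (simp add: power_reflect_def)
    have "snd (power_reflect {..<n} p q (dom_set B) g) cs \<in> dom_set B"
      using operation_closed[of "power_reflect {..<n} p q (dom_set B) g"] q g cs Pol_operation
      by fastforce
    then show ?thesis by (simp add: Q_def e)
  qed
  have "\<exists>rs. set rs = interp B R" if "R \<in> symbols B" for R
    using finite_list[OF finite_subset[OF interp_subset_tuples[OF B(1) that] finite_tuples[OF B(2)]]] .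
  then obtain rs where rs: "\<And>R. R \<in> symbols B \<Longrightarrow> set (rs R) = interp B R" by metis
  have rsB: "rs R \<in> tuples (tuples (dom_set B) (arity B R)) (length (rs R))"
    if "R \<in> symbols B" for R
    using rs[OF that] interp_subset_tuples[OF B(1) that] by (auto simp: tuples_def)
  \<comment> \<open>The tuple of points of \<open>?X\<close> generated by \<open>g\<close> from the enumerated relation.\<close>
  define row where
    "row R g = map (\<lambda>j. act g n (map P (map (\<lambda>t. t ! j) (rs R)))) [0..<arity B R]" for R g
  let ?G = "\<lambda>R. {g \<in> Pol A. fst g = length (rs R)}"
  define D where "D = \<lparr>dom_set = ?X, symbols = symbols B, arity = arity B,
    interp = \<lambda>R. row R ` ?G R\<rparr>"
  have row: "row R g \<in> tuples ?X (arity B R)" if R: "R \<in> symbols B" and g: "g \<in> ?G R" for R g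
  proof -
    have "act g n (map P (map (\<lambda>t. t ! j) (rs R))) \<in> ?X" if "j < arity B R" for j
    proof (rule act_in_tuples)
      show "g \<in> operations (dom_set A)" using g Pol_operation by blast
      show "map P (map (\<lambda>t. t ! j) (rs R)) \<in> tuples ?X (fst g)"
        by (rule map_in_tuples[of _ "dom_set B"]) (use column_in_tuples[OF rsB[OF R] that] g P in auto)
    qed
    then show ?thesis by (auto simp: row_def tuples_def[of ?X])
  qed
  have "\<exists>a. a \<in> dom_set A" using A(1) by (auto simp: is_structure_def)
  then have "?X \<noteq> {}" by (metis P b0 empty_iff)
  then have D: "is_structure D" using row by (auto simp: is_structure_def D_def)
  moreover have "pp_definable A (arity D R * n) (concat ` interp D R)" if "R \<in> symbols D" for R
  proof -
    have R: "R \<in> symbols B" using that by (simp add: D_def)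
    let ?ts = "map concat (map (map P) (rs R))"
    have eq: "concat (row R g) = act g (arity B R * n) ?ts" for g
    proof -
      have "act g (arity B R * n) ?ts =
          concat (map (\<lambda>j. act g n (map (\<lambda>ts. ts ! j) (map (map P) (rs R)))) [0..<arity B R])"
        by (rule act_concat) (use rsB[OF R] in \<open>auto simp: tuples_def P_def\<close>)
      also have "map (\<lambda>j. act g n (map (\<lambda>ts. ts ! j) (map (map P) (rs R)))) [0..<arity B R] = row R g"
        unfolding row_def by (rule map_cong[OF refl]) (subst map_column[OF rsB[OF R]], auto)
      finally show ?thesis by simp
    qed
    have "concat ` interp D R = (\<lambda>g. act g (arity B R * n) ?ts) ` ?G R"
      unfolding eq[symmetric] by (simp add: D_def image_image)
    then have S: "concat ` interp D R =
        {act g (arity B R * n) ?ts |g. g \<in> Pol A \<and> fst g = length ?ts}" by auto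
    show ?thesis
    proof (cases "rs R = []")
      \<comment> \<open>An empty relation generates nothing, since operations have positive arity.\<close>
      case True
      then have "concat ` interp D R = {}" unfolding S using Pol_arity_pos by fastforce
      then show ?thesis by (simp add: pp_definable_def)
    next
      case False
      have "concat (map P t) \<in> tuples (dom_set A) (arity B R * n)"
        if "t \<in> set (rs R)" for t
      proof -
        have t: "length t = arity B R" "set t \<subseteq> dom_set B"
          using that rsB[OF R] by (auto simp: tuples_def)
        have "length (concat (map P t)) = length (map P t) * n"
          by (rule length_concat_uniform) (simp add: P_def)
        then show ?thesis using t P by (fastforce simp: tuples_def)
      qed
      then have "set ?ts \<subseteq> tuples (dom_set A) (arity B R * n)" by auto
      then have "pp_definable A (arity B R * n) (concat ` interp D R)"
        unfolding S by (intro pp_definable_generated[OF A]) (use False in auto)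
      then show ?thesis by (simp add: D_def)
    qed
  qed
  moreover have "hom_equivalent B D"
  proof -
    have "homomorphism B D P"
      unfolding homomorphism_def
    proof (intro conjI ballI)
      show "P \<in> dom_set B \<rightarrow> dom_set D" using P by (simp add: D_def)
      fix R t assume R: "R \<in> symbols B" and "t \<in> interp B R"
      then obtain i where i: "i < length (rs R)" "t = rs R ! i"
        using rs[OF R] by (metis in_set_conv_nth)
      let ?g = "projection (dom_set A) (length (rs R)) i"
      have "?g \<in> ?G R" using projection_in_Pol[OF A(1) i(1)] by (simp add: projection_def)
      moreover have "map P t = row R ?g"
      proof (rule nth_equalityI)
        have len: "length t = arity B R" using rsB[OF R] nth_mem[OF i(1)] i(2) by (auto simp: tuples_def)
        then show "length (map P t) = length (row R ?g)" by (simp add: row_def)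
        fix j assume "j < length (map P t)"
        then have j: "j < arity B R" using len by simp
        have "map P (map (\<lambda>t. t ! j) (rs R)) \<in> tuples ?X (length (rs R))"
          using column_in_tuples[OF rsB[OF R] j] P by (rule map_in_tuples)
        from act_projection[OF this i(1)] show "map P t ! j = row R ?g ! j"
          using i j len by (simp add: row_def)
      qed
      ultimately show "map P t \<in> interp D R" by (simp add: D_def)
    qed
    moreover have "homomorphism D B Q"
      unfolding homomorphism_def
    proof (intro conjI ballI)
      show "Q \<in> dom_set D \<rightarrow> dom_set B" using Q by simp
      fix R t assume "R \<in> symbols D" and "t \<in> interp D R"
      then obtain g where R: "R \<in> symbols B" and g: "g \<in> Pol A" "fst g = length (rs R)"
        and t: "t = row R g" by (auto simp: D_def)
      let ?h = "power_reflect {..<n} p q (dom_set B) g"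
      have "rs R \<in> tuples (interp B R) (fst ?h)" using rs[OF R] g by (simp add: tuples_def)
      then have "act ?h (arity B R) (rs R) \<in> interp B R" using Pol_act[OF _ R] q g by blast
      also have "act ?h (arity B R) (rs R) = map Q t"
        using QP[OF g(1)] column_in_tuples[OF rsB[OF R]] g(2)
        by (intro nth_equalityI) (simp_all add: t row_def del: map_map)
      finally show "map Q t \<in> interp B R" .
    qed
    ultimately show ?thesis
      unfolding hom_equivalent_def by (auto simp: D_def same_signature_def)
  qed
  moreover have "dom_set D = ?X" by (simp add: D_def)
  ultimately show thesis using that[OF n] by blast
qed


section \<open>The operators E, R and P\<close>

text \<open>Operators unfolded to the maps of the reflection: the enlarged set of operations keeps the domain,
  so the domain of the reflection is determined.\<close>

lemma E_R_op_iff: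
  "(B, G) \<in> E_op (R_op K) \<longleftrightarrow> G \<subseteq> operations B \<and>
    (\<exists>\<C>\<in>K. \<exists>h1 h2. h1 \<in> B \<rightarrow> fst \<C> \<and> h2 \<in> fst \<C> \<rightarrow> B \<and>
      snd (reflection B h1 h2 \<C>) \<subseteq> G)" (is "_ \<longleftrightarrow> ?R")
proof
  assume "(B, G) \<in> E_op (R_op K)"
  then obtain F B' h1 h2 \<C> where "G \<subseteq> operations B" "F \<subseteq> G" "\<C> \<in> K"
    and h: "h1 \<in> B' \<rightarrow> fst \<C>" "h2 \<in> fst \<C> \<rightarrow> B'" and F: "(B, F) = reflection B' h1 h2 \<C>"
    unfolding E_op_def R_op_def by blast
  moreover have "B' = B" "F = snd (reflection B' h1 h2 \<C>)"
    using arg_cong[OF F, of fst] arg_cong[OF F, of snd] by (simp_all add: reflection_def)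
  ultimately show ?R by blast
next
  assume ?R
  then obtain \<C> h1 h2 where "G \<subseteq> operations B" "\<C> \<in> K" "h1 \<in> B \<rightarrow> fst \<C>" "h2 \<in> fst \<C> \<rightarrow> B"
    and "snd (reflection B h1 h2 \<C>) \<subseteq> G" by blast
  moreover have "(B, snd (reflection B h1 h2 \<C>)) = reflection B h1 h2 \<C>"
    by (simp add: reflection_def)
  ultimately show "(B, G) \<in> E_op (R_op K)" unfolding E_op_def R_op_def by blast
qed

lemma reflection_power_algebra:
  assumes "h1 \<in> B \<rightarrow> (I \<rightarrow>\<^sub>E A)"
  shows "snd (reflection B h1 h2 (power_algebra I (A, F))) = power_reflect I h1 h2 B ` F"
proof -
  have "map h1 xs \<in> tuples (I \<rightarrow>\<^sub>E A) n" if "xs \<in> tuples B n" for xs n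
    using that by (rule map_in_tuples) (use assms in auto)
  then have "(\<lambda>xs\<in>tuples B n. h2 ((\<lambda>xs\<in>tuples (I \<rightarrow>\<^sub>E A) n. \<lambda>i\<in>I. f (map (\<lambda>x. x i) xs)) (map h1 xs))) =
      (\<lambda>xs\<in>tuples B n. h2 (\<lambda>i\<in>I. f (map (\<lambda>c. h1 c i) xs)))" for n and f :: "'c list \<Rightarrow> 'c"
    by (intro restrict_ext) (simp add: comp_def)
  then show ?thesis
    by (simp add: reflection_def power_algebra_def power_reflect_def image_image case_prod_beta Let_def)
qed

lemma E_R_power_iff:
  "(B, G) \<in> E_op (R_op {power_algebra I (A, F) |I. Q I}) \<longleftrightarrow> G \<subseteq> operations B \<and>
    (\<exists>I h1 h2. Q I \<and> h1 \<in> B \<rightarrow> (I \<rightarrow>\<^sub>E A) \<and> h2 \<in> (I \<rightarrow>\<^sub>E A) \<rightarrow> B \<and>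
      (\<forall>f\<in>F. power_reflect I h1 h2 B f \<in> G))"
proof -
  have fst: "fst (power_algebra I (A, F)) = (I \<rightarrow>\<^sub>E A)" for I
    by (simp add: power_algebra_def Let_def)
  have "h1 \<in> B \<rightarrow> fst (power_algebra I (A, F)) \<and> h2 \<in> fst (power_algebra I (A, F)) \<rightarrow> B \<and>
      snd (reflection B h1 h2 (power_algebra I (A, F))) \<subseteq> G \<longleftrightarrow>
    h1 \<in> B \<rightarrow> (I \<rightarrow>\<^sub>E A) \<and> h2 \<in> (I \<rightarrow>\<^sub>E A) \<rightarrow> B \<and>
      (\<forall>f\<in>F. power_reflect I h1 h2 B f \<in> G)" for I h1 h2
    unfolding fst by (auto simp only: reflection_power_algebra image_subset_iff)
  note key = this
  have bex: "(\<exists>\<C>\<in>{power_algebra I (A, F) |I. Q I}. \<Phi> \<C>) \<longleftrightarrow>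
      (\<exists>I. Q I \<and> \<Phi> (power_algebra I (A, F)))" for \<Phi> by blast
  show ?thesis unfolding E_R_op_iff bex key by blast
qed

lemma P_op_singleton: "P_op TYPE('i) {\<A>} = {power_algebra I \<A> |I. I \<noteq> {}}"
  unfolding P_op_def by blast

lemma Pfin_op_singleton: "Pfin_op TYPE('i) {\<A>} = {power_algebra I \<A> |I. I \<noteq> {} \<and> finite I}"
  unfolding Pfin_op_def by blast

lemma E_R_P_op_h1:
  assumes "(B, G) \<in> E_op (R_op (P_op TYPE('i) {(A, F)}))"
  shows "\<exists>\<xi>. h1_clone_homomorphism A F B G \<xi>"
proof -
  obtain I :: "'i set" and h1 h2 where h: "h1 \<in> B \<rightarrow> (I \<rightarrow>\<^sub>E A)"
    and "\<forall>f\<in>F. power_reflect I h1 h2 B f \<in> G"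
    using assms unfolding P_op_singleton E_R_power_iff by metis
  then have "h1_clone_homomorphism A F B G (power_reflect I h1 h2 B)"
    by (intro h1_power_reflect) auto
  then show ?thesis by blast
qed

text \<open>A finite index set is renumbered by an initial segment of the naturals.\<close>

lemma E_R_Pfin_op_finite_power_reflection:
  assumes "(dom_set B, Pol B) \<in> E_op (R_op (Pfin_op TYPE('i) {(dom_set A, Pol A)}))"
  shows "finite_power_reflection A B"
proof -
  obtain I :: "'i set" and h1 h2 where I: "I \<noteq> {}" "finite I"
    and h1: "h1 \<in> dom_set B \<rightarrow> (I \<rightarrow>\<^sub>E dom_set A)"
    and refl: "\<forall>f\<in>Pol A. power_reflect I h1 h2 (dom_set B) f \<in> Pol B"
    using assms unfolding Pfin_op_singleton E_R_power_iff by metis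
  define n where "n = card I"
  have n: "1 \<le> n" using I card_0_eq[OF I(2)] by (simp add: n_def Suc_le_eq card_gt_0_iff)
  obtain e where e: "bij_betw e {..<n} I"
    using ex_bij_betw_nat_finite[OF I(2)] by (auto simp: n_def lessThan_atLeast0)
  let ?i = "inv_into {..<n} e"
  let ?p = "\<lambda>c j. h1 c (e j)" and ?q = "\<lambda>x. h2 (\<lambda>i\<in>I. x (?i i))"
  have inv: "?i i \<in> {..<n}" "e (?i i) = i" if "i \<in> I" for i
    using e that bij_betw_inv_into_right[OF e] bij_betw_inv_into[OF e]
    by (auto simp: bij_betw_def)
  have "power_reflect {..<n} ?p ?q (dom_set B) f = power_reflect I h1 h2 (dom_set B) f" for f
  proof -
    have "(\<lambda>i\<in>I. (\<lambda>j\<in>{..<n}. snd f (map (\<lambda>c. h1 c (e j)) cs)) (?i i)) =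
        (\<lambda>i\<in>I. snd f (map (\<lambda>c. h1 c i) cs))" for cs
      by (intro restrict_ext) (use inv in auto)
    then show ?thesis by (simp only: power_reflect_def)
  qed
  moreover have "\<forall>c\<in>dom_set B. \<forall>j<n. h1 c (e j) \<in> dom_set A"
    using h1 e by (auto simp: bij_betw_def)
  ultimately show ?thesis unfolding finite_power_reflection_def
    using n refl by (intro exI[of _ n] exI[of _ ?p] exI[of _ ?q]) simp
qed

text \<open>The free-algebra argument. The index set is a copy of the $N$-tuples over $A$, with \<open>N\<close> the size
  of \<open>B\<close>, so points of the power are \<open>N\<close>-ary operation tables: \<open>h1\<close> sends the elements of \<open>B\<close> to the
  projections, and \<open>h2\<close> evaluates the image under \<open>\<xi>\<close> at the list \<open>bs\<close> of all elements of \<open>B\<close>.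
  Applying \<open>g\<close> to projections gives a minor of \<open>g\<close>, and the h1 condition is exactly what turns
  its image, evaluated at \<open>bs\<close>, into \<open>\<xi> g\<close> evaluated at the chosen elements.\<close>

lemma h1_E_R_Pfin_op:
  fixes A :: "('a, 's) rel_structure" and B :: "('b, 't) rel_structure"
  assumes A: "is_structure A" "finite (dom_set A)" and B: "is_structure B" "finite (dom_set B)"
    and \<xi>: "h1_clone_homomorphism (dom_set A) (Pol A) (dom_set B) (Pol B) \<xi>"
  shows "(dom_set B, Pol B) \<in> E_op (R_op (Pfin_op TYPE('i::infinite) {(dom_set A, Pol A)}))"
proof -
  obtain bs where bs: "set bs = dom_set B" "distinct bs" using finite_distinct_list[OF B(2)] by blast
  define N where "N = length bs"
  have N: "1 \<le> N" using B(1) bs(1) by (cases bs) (auto simp: N_def is_structure_def)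
  have bsN: "bs \<in> tuples (dom_set B) N" using bs by (simp add: tuples_def N_def)
  have "\<forall>b\<in>dom_set B. \<exists>i. i < N \<and> bs ! i = b" by (simp add: N_def in_set_conv_nth flip: bs(1))
  then obtain idx where idx': "\<forall>b\<in>dom_set B. idx b < N \<and> bs ! idx b = b"
    by (rule bchoice[THEN exE])
  note idx = bspec[OF idx']
  let ?T = "tuples (dom_set A) N"
  have finT: "finite ?T" using A(2) by (rule finite_tuples)
  obtain a where "a \<in> dom_set A" using A(1) by (auto simp: is_structure_def)
  then have "replicate N a \<in> ?T" by (auto simp: tuples_def)
  then have neT: "?T \<noteq> {}" by blast
  obtain I :: "'i set" where I: "finite I" "card I = card ?T"
    using infinite_arbitrarily_large[OF infinite_UNIV] by blast
  then obtain e where e: "bij_betw e I ?T" using finite_same_card_bij[OF I(1) finT] by blast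
  have eT: "e i \<in> ?T" if "i \<in> I" for i using e that by (auto simp: bij_betw_def)
  define h1 where "h1 b = (\<lambda>i\<in>I. e i ! idx b)" for b
  define table where "table g = (\<lambda>i\<in>I. snd g (e i))" for g :: "'a operation"
  define ops where "ops = {g \<in> Pol A. fst g = N}"
  \<comment> \<open>Every \<open>N\<close>-tuple occurs as an index, so a table determines its operation and \<open>h2\<close> is well defined.\<close>
  have inj: "inj_on table ops"
  proof (rule inj_onI)
    fix g g' assume g: "g \<in> ops" "g' \<in> ops" "table g = table g'"
    have "snd g xs = snd g' xs" if "xs \<in> ?T" for xs
    proof -
      have "xs \<in> e ` I" using e that by (simp add: bij_betw_def)
      then obtain i where "i \<in> I" "xs = e i" by blast
      then show ?thesis using fun_cong[OF g(3), of i] by (simp add: table_def)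
    qed
    then show "g = g'"
      using g by (intro operation_eqI[of _ "dom_set A"]) (auto simp: ops_def Pol_operation)
  qed
  define h2 where "h2 x = (if x \<in> table ` ops then snd (\<xi> (inv_into ops table x)) bs else bs ! 0)" for x
  have h2: "h2 (table g) = snd (\<xi> g) bs" if "g \<in> ops" for g
    using that inj by (simp add: h2_def)
  have \<xi>Pol: "\<xi> g \<in> Pol B" "fst (\<xi> g) = fst g" if "g \<in> Pol A" for g
    using \<xi> that by (auto simp: h1_clone_homomorphism_def)
  have "power_reflect I h1 h2 (dom_set B) g = \<xi> g" if g: "g \<in> Pol A" for g
  proof -
    have "h2 (\<lambda>i\<in>I. snd g (map (\<lambda>c. h1 c i) cs)) = snd (\<xi> g) cs"
      if cs: "cs \<in> tuples (dom_set B) (fst g)" for cs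
    proof -
      let ?is = "map idx cs"
      let ?g = "compose_op (dom_set A) N g (map (projection (dom_set A) N) ?is)"
      have "is": "?is \<in> tuples {..<N} (fst g)"
        using cs by (rule map_in_tuples) (use idx in auto)
      have ops: "?g \<in> ops" using minor_in_Pol[OF A(1) g N "is"] by (simp add: ops_def)
      have "table ?g = (\<lambda>i\<in>I. snd g (map (\<lambda>c. h1 c i) cs))"
        unfolding table_def
        by (intro restrict_ext, subst compose_projections[OF eT]) (simp_all add: h1_def comp_def)
      then have "h2 (\<lambda>i\<in>I. snd g (map (\<lambda>c. h1 c i) cs)) = snd (\<xi> ?g) bs"
        using h2[OF ops] by simp
      also have "\<xi> ?g = compose_op (dom_set B) N (\<xi> g) (map (projection (dom_set B) N) ?is)"
        using \<xi> g N "is" unfolding h1_clone_homomorphism_def by blast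
      also have "snd \<dots> bs = snd (\<xi> g) (map ((!) bs) ?is)" using bsN by (rule compose_projections)
      also have "map ((!) bs) ?is = cs"
        using cs idx by (auto simp: tuples_def intro!: map_idI)
      finally show ?thesis .
    qed
    then show ?thesis
      using \<xi>Pol[OF g] Pol_arity_pos[OF g] operation_closed[OF Pol_operation[OF \<xi>Pol(1)[OF g]]]
      by (intro operation_eqI[of _ "dom_set B"])
        (auto simp: power_reflect_def Pol_operation intro!: restrict_operation)
  qed
  then have "\<forall>g\<in>Pol A. power_reflect I h1 h2 (dom_set B) g \<in> Pol B" using \<xi>Pol by simp
  moreover have "h1 \<in> dom_set B \<rightarrow> (I \<rightarrow>\<^sub>E dom_set A)"
  proof
    fix b assume "b \<in> dom_set B"
    then show "h1 b \<in> I \<rightarrow>\<^sub>E dom_set A"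
      using idx eT by (fastforce simp: h1_def tuples_def)
  qed
  moreover have "h2 \<in> (I \<rightarrow>\<^sub>E dom_set A) \<rightarrow> dom_set B"
  proof
    fix x :: "'i \<Rightarrow> 'a"
    have "snd (\<xi> g) bs \<in> dom_set B" if "g \<in> ops" for g
      using that \<xi>Pol[of g] bsN operation_closed[OF Pol_operation, of "\<xi> g" B bs]
      by (auto simp: ops_def)
    moreover have "bs ! 0 \<in> dom_set B" unfolding bs(1)[symmetric]
      using N by (intro nth_mem) (unfold N_def, linarith)
    ultimately show "h2 x \<in> dom_set B"
      using inv_into_into[of x table ops] by (simp add: h2_def)
  qed
  moreover have "I \<noteq> {}" using e neT by (auto simp: bij_betw_def)
  moreover have "Pol B \<subseteq> operations (dom_set B)" by (auto intro: Pol_operation)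
  ultimately show ?thesis unfolding Pfin_op_singleton E_R_power_iff using I(1)
    by (intro conjI exI[of _ I] exI[of _ h1] exI[of _ h2])
qed

lemma E_R_Pfin_op_subset_P_op:
  "x \<in> E_op (R_op (Pfin_op TYPE('i) K)) \<Longrightarrow> x \<in> E_op (R_op (P_op TYPE('i) K))"
proof -
  have "Pfin_op TYPE('i) K \<subseteq> P_op TYPE('i) K" by (auto simp: Pfin_op_def P_op_def)
  then show "x \<in> E_op (R_op (Pfin_op TYPE('i) K)) \<Longrightarrow> x \<in> E_op (R_op (P_op TYPE('i) K))"
    by (cases x) (auto simp only: E_R_op_iff)
qed


section \<open>The equivalence\<close>

text \<open>The pp-power is offered through all of its isomorphic copies, on a list type for condition (i) and
  on the universe type for a construction chain.\<close>

lemma h1_pp_power: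
  fixes A :: "('a, 's) rel_structure" and B :: "('b, 't) rel_structure"
  assumes A: "is_structure A" "finite (dom_set A)" and B: "is_structure B" "finite (dom_set B)"
    and \<xi>: "h1_clone_homomorphism (dom_set A) (Pol A) (dom_set B) (Pol B) \<xi>"
  obtains D :: "('a list, 't) rel_structure" where "finite (dom_set D)" "hom_equivalent B D"
    "\<And>C :: ('c, 't) rel_structure. is_structure C \<Longrightarrow> isomorphic C D \<Longrightarrow> pp_power A C"
    "is_structure D"
proof -
  have "finite_power_reflection A B"
    by (rule E_R_Pfin_op_finite_power_reflection[OF h1_E_R_Pfin_op[OF A B \<xi>, where 'i = nat]])
  then obtain D :: "('a list, 't) rel_structure" and n where n: "1 \<le> n"
    and D: "is_structure D" "dom_set D = tuples (dom_set A) n"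
    and pp: "\<And>R. R \<in> symbols D \<Longrightarrow> pp_definable A (arity D R * n) (concat ` interp D R)"
    and eq: "hom_equivalent B D"
    by (rule finite_power_reflection_pp_power[OF A B]) (rule that)
  have "pp_power A C" if "is_structure C" "isomorphic C D" for C :: "('c, 't) rel_structure"
    unfolding pp_power_def using that n D pp by blast
  moreover have "finite (dom_set D)" using D finite_tuples[OF A(2)] by simp
  ultimately show thesis using that eq D(1) by blast
qed

lemma pp_power_hom_equivalent_iff_h1:
  fixes A :: "('a, 's) rel_structure" and B :: "('b, 't) rel_structure"
  assumes A: "is_structure A" "finite (dom_set A)" and B: "is_structure B" "finite (dom_set B)"
  shows "(\<exists>C :: ('a list, 't) rel_structure. pp_power A C \<and> hom_equivalent B C) \<longleftrightarrow>
    (\<exists>\<xi>. h1_clone_homomorphism (dom_set A) (Pol A) (dom_set B) (Pol B) \<xi>)"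
proof
  assume "\<exists>C :: ('a list, 't) rel_structure. pp_power A C \<and> hom_equivalent B C"
  then obtain C :: "('a list, 't) rel_structure" where C: "pp_power A C" "hom_equivalent B C"
    by blast
  have s: "is_structure C" using C(1) by (simp add: pp_power_def)
  obtain \<xi> where "h1_clone_homomorphism (dom_set A) (Pol A) (dom_set C) (Pol C) \<xi>"
    using finite_power_reflection_h1[OF
      pp_interprets_finite_power_reflection[OF A(1) s pp_power_pp_interprets[OF A(1) C(1)]]] by blast
  moreover obtain \<zeta> where "h1_clone_homomorphism (dom_set C) (Pol C) (dom_set B) (Pol B) \<zeta>"
    using hom_equivalent_h1[OF s B(1) hom_equivalent_sym[OF C(2)]] by blast
  ultimately show "\<exists>\<xi>. h1_clone_homomorphism (dom_set A) (Pol A) (dom_set B) (Pol B) \<xi>"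
    using h1_clone_homomorphism_trans by blast
next
  assume "\<exists>\<xi>. h1_clone_homomorphism (dom_set A) (Pol A) (dom_set B) (Pol B) \<xi>"
  then obtain \<xi> where "h1_clone_homomorphism (dom_set A) (Pol A) (dom_set B) (Pol B) \<xi>" ..
  then obtain D :: "('a list, 't) rel_structure" where "hom_equivalent B D" "pp_power A D"
    using h1_pp_power[OF A B, where 'c = "'a list"] isomorphic_refl by metis
  then show "\<exists>C :: ('a list, 't) rel_structure. pp_power A C \<and> hom_equivalent B C" by blast
qed

text \<open>From right to left, the chain has two steps: interpret a copy of the pp-power, then pass to the
  homomorphically equivalent copy of \<open>B\<close>.\<close>

lemma pp_constructible_iff_h1:
  fixes A :: "('a, 's) rel_structure" and B :: "('b, 's) rel_structure"
  assumes A: "is_structure A" "finite (dom_set A)" and B: "is_structure B" "finite (dom_set B)"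
  shows "pp_constructible TYPE('u::infinite) A B \<longleftrightarrow>
    (\<exists>\<xi>. h1_clone_homomorphism (dom_set A) (Pol A) (dom_set B) (Pol B) \<xi>)"
proof
  assume "pp_constructible TYPE('u) A B"
  then obtain A' B' :: "('u, 's) rel_structure" where A': "is_structure A'" "isomorphic A A'"
    and B': "is_structure B'" "isomorphic B' B" and steps: "pp_construction_step\<^sup>*\<^sup>* A' B'"
    unfolding pp_constructible_def by blast
  have "finite (dom_set A')"
    using A'(2) A(2) by (auto simp: isomorphic_def isomorphism_def dest: bij_betw_finite)
  then have "\<exists>\<xi>. h1_clone_homomorphism (dom_set A') (Pol A') (dom_set B') (Pol B') \<xi>"
    using pp_construction_chain_h1[OF steps A'(1)] by blast
  moreover have "\<exists>\<xi>. h1_clone_homomorphism (dom_set A) (Pol A) (dom_set A') (Pol A') \<xi>"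
    by (intro hom_equivalent_h1 isomorphic_hom_equivalent A A')
  moreover have "\<exists>\<xi>. h1_clone_homomorphism (dom_set B') (Pol B') (dom_set B) (Pol B) \<xi>"
    by (intro hom_equivalent_h1 isomorphic_hom_equivalent B B')
  ultimately show "\<exists>\<xi>. h1_clone_homomorphism (dom_set A) (Pol A) (dom_set B) (Pol B) \<xi>"
    using h1_clone_homomorphism_trans by meson
next
  assume h1: "\<exists>\<xi>. h1_clone_homomorphism (dom_set A) (Pol A) (dom_set B) (Pol B) \<xi>"
  obtain A' :: "('u, 's) rel_structure" where A': "is_structure A'" "finite (dom_set A')"
    "isomorphic A' A" by (rule finite_structure_copy[OF A])
  obtain B' :: "('u, 's) rel_structure" where B': "is_structure B'" "finite (dom_set B')"
    "isomorphic B' B" by (rule finite_structure_copy[OF B])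
  have "\<exists>\<xi>. h1_clone_homomorphism (dom_set A') (Pol A') (dom_set A) (Pol A) \<xi>"
    by (intro hom_equivalent_h1 isomorphic_hom_equivalent A A')
  moreover have "\<exists>\<xi>. h1_clone_homomorphism (dom_set B) (Pol B) (dom_set B') (Pol B') \<xi>"
    by (intro hom_equivalent_h1 hom_equivalent_sym[OF isomorphic_hom_equivalent] B B')
  ultimately obtain \<xi> where \<xi>: "h1_clone_homomorphism (dom_set A') (Pol A') (dom_set B') (Pol B') \<xi>"
    using h1 h1_clone_homomorphism_trans by meson
  obtain D :: "('u list, 's) rel_structure" where D: "finite (dom_set D)" "hom_equivalent B' D"
    "\<And>C :: ('u, 's) rel_structure. is_structure C \<Longrightarrow> isomorphic C D \<Longrightarrow> pp_power A' C"
    "is_structure D"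
    using h1_pp_power[OF A'(1,2) B'(1,2) \<xi>] by blast
  obtain C :: "('u, 's) rel_structure" where C: "is_structure C" "isomorphic C D"
    by (rule finite_structure_copy[OF D(4,1)])
  have "pp_interprets A' C" by (intro pp_power_pp_interprets A' D(3) C)
  then have "pp_construction_step A' C" using A' C by (simp add: pp_construction_step_def)
  moreover have "hom_equivalent C B'"
    using hom_equivalent_trans[OF isomorphic_hom_equivalent[OF C(1) D(4) C(2)]
      hom_equivalent_sym[OF D(2)]] .
  then have "pp_construction_step C B'" using B' C by (simp add: pp_construction_step_def)
  ultimately have "pp_construction_step\<^sup>*\<^sup>* A' B'" by simp
  then show "pp_constructible TYPE('u) A B"
    unfolding pp_constructible_def using A' B' isomorphic_sym by blast
qed

theorem theorem1p3:
  fixes A :: "('a, 's) rel_structure" and B :: "('b, 's) rel_structure"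
  assumes "is_structure A" and "finite (dom_set A)"
    and "is_structure B" and "finite (dom_set B)"
  shows "let
      i = (\<exists>C :: ('a list, 's) rel_structure. pp_power A C \<and> hom_equivalent B C);
      i' = pp_constructible TYPE('u::infinite) A B;
      ii = (dom_set B, Pol B) \<in> E_op (R_op (Pfin_op TYPE('i::infinite) {(dom_set A, Pol A)}));
      ii' = (dom_set B, Pol B) \<in> E_op (R_op (P_op TYPE('i) {(dom_set A, Pol A)}));
      iii = (\<exists>\<xi>. h1_clone_homomorphism (dom_set A) (Pol A) (dom_set B) (Pol B) \<xi>)
    in (i \<longleftrightarrow> i') \<and> (i \<longleftrightarrow> ii) \<and> (i \<longleftrightarrow> ii') \<and> (i \<longleftrightarrow> iii)"
  unfolding Let_def pp_power_hom_equivalent_iff_h1[OF assms] pp_constructible_iff_h1[OF assms]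
  using h1_E_R_Pfin_op[OF assms] E_R_Pfin_op_subset_P_op E_R_P_op_h1 by blast

end
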